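(* Let $n\ge 5$ be an integer and let $\mathfrak S_{(n,4)}$ be the numerical semigroup generated by $m_0=n^2+2n$, $m_1=n^2+2n+1$, $m_2=n^2+3n+1$, $m_3=n^2+3n+2$. Then the tangent cone $G_{\mathfrak m}(\mathfrak S_{(n,4)})$ is Cohen-Macaulay.
   Context: Fix a field $K$. For a numerical semigroup $\Gamma$ generated by $a_1<\dots<a_e$, let $R=K[[t^{a_1},\dots,t^{a_e}]]\subset K[[t]]$ with maximal ideal $\mathfrak m=(t^{a_1},\dots,t^{a_e})$. The tangent cone of $\Gamma$ is the associated graded ring $G_{\mathfrak m}(\Gamma)=\bigoplus_{n\ge 0}\mathfrak m^n/\mathfrak m^{n+1}$. *)

theory Defs
  imports
    "HOL-Algebra.Ring_Divisibility"
    "HOL-Algebra.Ideal_Product"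
    "HOL-Algebra.Subrings"
    "HOL-Algebra.UnivPoly"
    "HOL-Algebra.Algebraic_Closure_Type"
    "HOL-Computational_Algebra.Formal_Power_Series"
    "HOL-Library.Extended_Nat"
begin

section \<open>Cohen--Macaulay rings\<close>

text \<open>
  \<open>xs = [x\<^sub>1, \<dots>, x\<^sub>k]\<close> is a regular sequence if \<open>(x\<^sub>1, \<dots>, x\<^sub>k) \<noteq> R\<close> and each \<open>x\<^sub>i\<close> is a
  nonzerodivisor on \<open>R/(x\<^sub>1, \<dots>, x\<^sub>i\<^sub>-\<^sub>1)\<close>; the latter is written out as
  \<open>x\<^sub>i y \<in> (x\<^sub>1, \<dots>, x\<^sub>i\<^sub>-\<^sub>1) \<Longrightarrow> y \<in> (x\<^sub>1, \<dots>, x\<^sub>i\<^sub>-\<^sub>1)\<close>.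
\<close>

definition regular_sequence :: "('a, 'b) ring_scheme \<Rightarrow> 'a list \<Rightarrow> bool" where
  "regular_sequence R xs \<longleftrightarrow>
     set xs \<subseteq> carrier R \<and>
     Idl\<^bsub>R\<^esub> (set xs) \<noteq> carrier R \<and>
     (\<forall>i < length xs. \<forall>y \<in> carrier R.
        xs ! i \<otimes>\<^bsub>R\<^esub> y \<in> Idl\<^bsub>R\<^esub> (set (take i xs)) \<longrightarrow> y \<in> Idl\<^bsub>R\<^esub> (set (take i xs)))"

text \<open>The length of a longest regular sequence in \<open>I\<close> (in a Noetherian ring, with \<open>I\<close> proper, all
  maximal ones have this length).\<close>

definition ideal_depth :: "('a, 'b) ring_scheme \<Rightarrow> 'a set \<Rightarrow> enat" where
  "ideal_depth R I = (SUP xs \<in> {xs. regular_sequence R xs \<and> set xs \<subseteq> I}. enat (length xs))"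

text \<open>The height (codimension) of a prime \<open>P\<close>, i.e. the Krull dimension of \<open>R\<^sub>P\<close>: a strictly
  ascending chain of \<open>k + 1\<close> primes ending in \<open>P\<close> has length \<open>k\<close>.\<close>

definition height :: "('a, 'b) ring_scheme \<Rightarrow> 'a set \<Rightarrow> enat" where
  "height R P =
     (SUP Ps \<in> {Ps. Ps \<noteq> [] \<and> (\<forall>Q \<in> set Ps. primeideal Q R) \<and> sorted_wrt (\<subset>) Ps \<and> last Ps = P}.
        enat (length Ps - 1))"

text \<open>
  The definition of Eisenbud, \<^emph>\<open>Commutative Algebra\<close>, Section 18.2, for a ring that need not be local:
  \<open>R\<close> is Noetherian and \<open>depth P = codim P\<close> for every maximal ideal \<open>P\<close>.
\<close>

definition Cohen_Macaulay :: "('a, 'b) ring_scheme \<Rightarrow> bool" where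
  "Cohen_Macaulay R \<longleftrightarrow>
     cring R \<and> noetherian_ring R \<and> (\<forall>P. maximalideal P R \<longrightarrow> ideal_depth R P = height R P)"


section \<open>The associated graded ring of an ideal\<close>

abbreviation ideal_power :: "('a, 'b) ring_scheme \<Rightarrow> 'a set \<Rightarrow> nat \<Rightarrow> 'a set" where
  "ideal_power R I n \<equiv> I [^]\<^bsub>ideals_set R\<^esub> n"

text \<open>
  An element of the direct sum of the \<open>I\<^sup>n/I\<^sup>n\<^sup>+\<^sup>1\<close> is a finitely supported family \<open>x\<close>, where \<open>x n\<close> is a
  coset of \<open>I\<^sup>n\<^sup>+\<^sup>1\<close> (so that its zero is \<open>I\<^sup>n\<^sup>+\<^sup>1\<close> itself).  The product of \<open>a + I\<^sup>i\<^sup>+\<^sup>1\<close> and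
  \<open>b + I\<^sup>j\<^sup>+\<^sup>1\<close>, with \<open>a \<in> I\<^sup>i\<close> and \<open>b \<in> I\<^sup>j\<close>, is \<open>ab + I\<^sup>i\<^sup>+\<^sup>j\<^sup>+\<^sup>1\<close>; \<^const>\<open>rcoset_mult\<close> denotes the union
  of these cosets over all representatives, which all agree.
\<close>

definition assoc_graded :: "('a, 'b) ring_scheme \<Rightarrow> 'a set \<Rightarrow> (nat \<Rightarrow> 'a set) ring" where
  "assoc_graded R I =
     \<lparr>carrier = {x. (\<forall>n. \<exists>a \<in> ideal_power R I n. x n = ideal_power R I (Suc n) +>\<^bsub>R\<^esub> a) \<and>
                    finite {n. x n \<noteq> ideal_power R I (Suc n)}},
      monoid.mult = (\<lambda>x y n. \<Oplus>\<^bsub>R Quot ideal_power R I (Suc n)\<^esub>i\<in>{..n}.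
                rcoset_mult R (ideal_power R I (Suc n)) (x i) (y (n - i))),
      monoid.one = (\<lambda>n. if n = 0 then ideal_power R I 1 +>\<^bsub>R\<^esub> \<one>\<^bsub>R\<^esub> else ideal_power R I (Suc n)),
      ring.zero = (\<lambda>n. ideal_power R I (Suc n)),
      ring.add = (\<lambda>x y n. x n <+>\<^bsub>R\<^esub> y n)\<rparr>"


lemma (in cring) ideal_ideal_power:
  assumes "ideal I R"
  shows "ideal (ideal_power R I n) R"
proof (induction n)
  case 0
  then show ?case by (simp add: ideals_set_def oneideal)
next
  case (Suc n)
  then show ?case
    using ideal_prod_is_ideal[OF Suc assms] by (simp add: ideals_set_def)
qed

lemma (in cring) ideal_power_mult:
  assumes I: "ideal I R" and "a \<in> ideal_power R I i" "b \<in> ideal_power R I j"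
  shows "a \<otimes> b \<in> ideal_power R I (i + j)"
proof -
  interpret M: Group.comm_monoid "ideals_set R" by (rule ideals_set_is_comm_monoid)
  have "a \<otimes> b \<in> ideal_prod R (ideal_power R I i) (ideal_power R I j)"
    using assms(2,3) by (rule ideal_prod.prod)
  also have "\<dots> = ideal_power R I i \<otimes>\<^bsub>ideals_set R\<^esub> ideal_power R I j"
    by (simp add: ideals_set_def)
  also have "\<dots> = ideal_power R I (i + j)"
    using I by (intro M.nat_pow_mult) (simp add: ideals_set_def)
  finally show ?thesis .
qed

lemma (in cring) ideal_power_mono:
  assumes I: "ideal I R" and "m \<le> n"
  shows "ideal_power R I n \<subseteq> ideal_power R I m"
  using \<open>m \<le> n\<close>
proof (induction n rule: dec_induct)
  case (step n)
  have "ideal_power R I (Suc n) = ideal_prod R (ideal_power R I n) I"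
    by (simp add: ideals_set_def)
  with ideal_prod_inter[OF ideal_ideal_power[OF I] I] step show ?case by blast
qed simp

lemma (in cring) graded_mult_cosets:
  assumes I: "ideal I R" and a: "a \<in> ideal_power R I i" and b: "b \<in> ideal_power R I j"
  shows "rcoset_mult R (ideal_power R I (Suc (i + j)))
           (ideal_power R I (Suc i) +> a) (ideal_power R I (Suc j) +> b) =
         ideal_power R I (Suc (i + j)) +> (a \<otimes> b)"
proof -
  let ?P = "\<lambda>n. ideal_power R I n"
  interpret Q: ideal "?P (Suc (i + j))" R by (rule ideal_ideal_power[OF I])
  note carr = ideal.Icarr[OF ideal_ideal_power[OF I]]
  have eq: "?P (Suc (i + j)) +> (a' \<otimes> b') = ?P (Suc (i + j)) +> (a \<otimes> b)"
    if a': "a' \<in> ?P (Suc i) +> a" and b': "b' \<in> ?P (Suc j) +> b" for a' b'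
  proof -
    from a' obtain h where h: "h \<in> ?P (Suc i)" "a' = h \<oplus> a" by (auto simp: a_r_coset_def')
    from b' obtain k where k: "k \<in> ?P (Suc j)" "b' = k \<oplus> b" by (auto simp: a_r_coset_def')
    note c = carr[OF a] carr[OF b] carr[OF h(1)] carr[OF k(1)]
    have "h \<otimes> k \<in> ?P (Suc (i + j))"
      using ideal_power_mult[OF I h(1) k(1)] ideal_power_mono[OF I, of "Suc (i + j)" "Suc i + Suc j"]
      by auto
    moreover have "h \<otimes> b \<in> ?P (Suc (i + j))" "a \<otimes> k \<in> ?P (Suc (i + j))"
      using ideal_power_mult[OF I h(1) b] ideal_power_mult[OF I a k(1)] by (simp_all del: nat_pow_Suc)
    ultimately have "h \<otimes> k \<oplus> h \<otimes> b \<oplus> a \<otimes> k \<in> ?P (Suc (i + j))" by (intro Q.a_closed)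
    moreover have "a' \<otimes> b' = (h \<otimes> k \<oplus> h \<otimes> b \<oplus> a \<otimes> k) \<oplus> a \<otimes> b"
      unfolding h(2) k(2) using c by algebra
    ultimately have "a' \<otimes> b' \<in> ?P (Suc (i + j)) +> (a \<otimes> b)" by (auto simp: a_r_coset_def')
    from Q.a_repr_independence'[OF this] show ?thesis using c by simp
  qed
  have self: "c \<in> ?P n +> c" if "c \<in> carrier R" for c n
    using abelian_subgroup.a_rcos_self[OF abelian_subgroupI3[OF ideal.axioms(1)[OF ideal_ideal_power[OF I]] is_abelian_group] that] .
  have "a \<in> ?P (Suc i) +> a" "b \<in> ?P (Suc j) +> b"
    using self carr[OF a] carr[OF b] by blast+
  then have ne: "?P (Suc i) +> a \<noteq> {}" "?P (Suc j) +> b \<noteq> {}" by blast+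
  have "rcoset_mult R (?P (Suc (i + j))) (?P (Suc i) +> a) (?P (Suc j) +> b) =
          (\<Union>a'\<in>?P (Suc i) +> a. \<Union>b'\<in>?P (Suc j) +> b. ?P (Suc (i + j)) +> (a \<otimes> b))"
    unfolding rcoset_mult_def by (intro SUP_cong refl eq)
  also have "\<dots> = ?P (Suc (i + j)) +> (a \<otimes> b)"
    by (simp only: SUP_const[OF ne(1)] SUP_const[OF ne(2)])
  finally show ?thesis .
qed

text \<open>The associated graded ring is the image of the ring of polynomials whose \<open>n\<close>-th coefficient
  lies in \<open>I\<^sup>n\<close>.\<close>

theorem (in cring) cring_assoc_graded:
  assumes I: "ideal I R"
  shows "cring (assoc_graded R I)"
proof -
  define P where "P n = ideal_power R I n" for n
  let ?U = "UP R" and ?G = "assoc_graded R I"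
  have mult: "p \<otimes>\<^bsub>?U\<^esub> q = (\<lambda>n. \<Oplus>i\<in>{..n}. p i \<otimes> q (n - i))"
    and add: "p \<oplus>\<^bsub>?U\<^esub> q = (\<lambda>n. p n \<oplus> q n)"
    if "p \<in> carrier ?U" "q \<in> carrier ?U" for p q
    using that by (simp_all add: UP_def)
  have one: "\<one>\<^bsub>?U\<^esub> = (\<lambda>n. if n = 0 then \<one> else \<zero>)" and zero: "\<zero>\<^bsub>?U\<^esub> = (\<lambda>n. \<zero>)"
    by (simp_all add: UP_def)
  have carrier_U: "p \<in> carrier ?U \<longleftrightarrow> (\<forall>n. p n \<in> carrier R) \<and> (\<exists>k. bound \<zero> k p)" for p
    by (auto simp: UP_def up_def)
  have coeff: "up_ring.coeff ?U p = p" if "p \<in> carrier ?U" for p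
    using that by (simp add: UP_def)
  interpret U: UP_cring R ?U by unfold_locales simp
  note ideal_P = ideal_ideal_power[OF I, folded P_def]
  note mult_P = ideal_power_mult[OF I, folded P_def]
  note cosets_P = graded_mult_cosets[OF I, folded P_def]
  note G_def = assoc_graded_def[of R I, folded P_def]
  note carr = ideal.Icarr[OF ideal_P]
  define B where "B = {p \<in> carrier ?U. \<forall>n. p n \<in> P n}"
  define h where "h p = (\<lambda>n. P (Suc n) +> p n)" for p :: "nat \<Rightarrow> 'a"
  have upD: "p n \<in> carrier R" if "p \<in> carrier ?U" for p n
    using that by (auto simp: UP_def up_def)
  have P0: "P 0 = carrier R" by (simp add: P_def ideals_set_def)
  have sumP: "(\<Oplus>i\<in>{..n}. f i) \<in> P n" if "\<And>i. i \<le> n \<Longrightarrow> f i \<in> P n" for f n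
  proof -
    interpret Q: ideal "P n" R by (rule ideal_P)
    have "(\<Oplus>i\<in>F. f i) \<in> P n" if "finite F" "F \<subseteq> {..n}" for F
      using that
    proof (induction F rule: finite_induct)
      case (insert x F)
      then have "f x \<in> P n" "f \<in> F \<rightarrow> carrier R"
        using \<open>\<And>i. i \<le> n \<Longrightarrow> f i \<in> P n\<close> carr by (auto)
      with insert show ?case using carr by simp
    qed simp
    then show ?thesis by blast
  qed
  have zP: "\<zero> \<in> P n" for n
    using additive_subgroup.zero_closed[OF ideal.axioms(1)[OF ideal_P]] .
  have neg: "(\<ominus>\<^bsub>?U\<^esub> p) n = \<ominus> p n" if "p \<in> carrier ?U" for p n
    using U.coeff_a_inv[OF that, of n] unfolding coeff[OF that] coeff[OF U.P.a_inv_closed[OF that]] .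
  have "subring B ?U"
  proof (rule U.P.subringI)
    show "B \<subseteq> carrier ?U" by (auto simp: B_def)
    show "\<one>\<^bsub>?U\<^esub> \<in> B" using P0 zP U.P.one_closed by (simp add: B_def one)
    show "\<ominus>\<^bsub>?U\<^esub> p \<in> B" if "p \<in> B" for p
      using that additive_subgroup.a_inv_closed[OF ideal.axioms(1)[OF ideal_P]]
      by (auto simp: B_def neg)
    show "p \<otimes>\<^bsub>?U\<^esub> q \<in> B" if p: "p \<in> B" and q: "q \<in> B" for p q
    proof -
      have "(\<Oplus>i\<in>{..n}. p i \<otimes> q (n - i)) \<in> P n" for n
      proof (rule sumP)
        fix i assume "i \<le> n"
        then show "p i \<otimes> q (n - i) \<in> P n"
          using mult_P[of "p i" i "q (n - i)" "n - i"] p q by (simp add: B_def)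
      qed
      then show ?thesis using p q U.P.m_closed[of p q] by (simp add: B_def mult)
    qed
    show "p \<oplus>\<^bsub>?U\<^esub> q \<in> B" if "p \<in> B" "q \<in> B" for p q
      using that U.P.a_closed[of p q] additive_subgroup.a_closed[OF ideal.axioms(1)[OF ideal_P]]
      by (auto simp: B_def add)
  qed
  define B' where "B' = ?U\<lparr>carrier := B\<rparr>"
  have B': "carrier B' = B" "\<And>p q. p \<otimes>\<^bsub>B'\<^esub> q = p \<otimes>\<^bsub>?U\<^esub> q" "\<And>p q. p \<oplus>\<^bsub>B'\<^esub> q = p \<oplus>\<^bsub>?U\<^esub> q"
    "\<one>\<^bsub>B'\<^esub> = \<one>\<^bsub>?U\<^esub>" "\<zero>\<^bsub>B'\<^esub> = \<zero>\<^bsub>?U\<^esub>"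
    by (simp_all add: B'_def)
  have cB: "cring B'"
    using U.P.subcringI'[OF \<open>subring B ?U\<close>] U.P.subcring_iff[of B] \<open>subring B ?U\<close>
      subringE(1) unfolding B'_def by blast
  then interpret B: cring B' .
  have coset0: "P (Suc n) +> \<zero> = P (Suc n)" for n
  proof -
    interpret Q: ideal "P (Suc n)" R by (rule ideal_P)
    show ?thesis by (rule a_coset_add_zero[OF Q.a_subset])
  qed
  have hmult: "h (p \<otimes>\<^bsub>?U\<^esub> q) = h p \<otimes>\<^bsub>?G\<^esub> h q" if p: "p \<in> B" and q: "q \<in> B" for p q
  proof
    fix n
    interpret Q: ideal "P (Suc n)" R by (rule ideal_P)
    interpret H: ring_hom_cring R "R Quot P (Suc n)" "(+>) (P (Suc n))"
      by (rule Q.rcos_ring_hom_cring) (rule is_cring)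
    have f: "(\<lambda>i. p i \<otimes> q (n - i)) \<in> {..n} \<rightarrow> carrier R"
      using p q upD by (auto simp: B_def)
    have "h (p \<otimes>\<^bsub>?U\<^esub> q) n = P (Suc n) +> (\<Oplus>i\<in>{..n}. p i \<otimes> q (n - i))"
      using p q by (simp add: h_def mult B_def)
    also have "\<dots> = (\<Oplus>\<^bsub>R Quot P (Suc n)\<^esub>i\<in>{..n}. ((+>) (P (Suc n)) \<circ> (\<lambda>i. p i \<otimes> q (n - i))) i)"
      by (rule H.hom_finsum[OF f])
    also have "\<dots> = (\<Oplus>\<^bsub>R Quot P (Suc n)\<^esub>i\<in>{..n}. rcoset_mult R (P (Suc n)) (h p i) (h q (n - i)))"
    proof (rule H.S.finsum_cong')
      have eq: "rcoset_mult R (P (Suc n)) (h p i) (h q (n - i)) = P (Suc n) +> (p i \<otimes> q (n - i))"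
        if "i \<in> {..n}" for i
        using that p q cosets_P[of "p i" i "q (n - i)" "n - i"]
        by (simp add: B_def h_def)
      show "((+>) (P (Suc n)) \<circ> (\<lambda>i. p i \<otimes> q (n - i))) i = rcoset_mult R (P (Suc n)) (h p i) (h q (n - i))"
        if "i \<in> {..n}" for i
        unfolding eq[OF that] by simp
      show "(\<lambda>i. rcoset_mult R (P (Suc n)) (h p i) (h q (n - i))) \<in> {..n} \<rightarrow> carrier (R Quot P (Suc n))"
      proof
        fix i assume i: "i \<in> {..n}"
        show "rcoset_mult R (P (Suc n)) (h p i) (h q (n - i)) \<in> carrier (R Quot P (Suc n))"
          unfolding eq[OF i] using Pi_mem[OF f i] by (rule H.hom_closed)
      qed
    qed simp
    finally show "h (p \<otimes>\<^bsub>?U\<^esub> q) n = (h p \<otimes>\<^bsub>?G\<^esub> h q) n" by (simp add: G_def)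
  qed
  have hadd: "h (p \<oplus>\<^bsub>?U\<^esub> q) = h p \<oplus>\<^bsub>?G\<^esub> h q" if p: "p \<in> B" and q: "q \<in> B" for p q
  proof
    fix n
    interpret Q: ideal "P (Suc n)" R by (rule ideal_P)
    show "h (p \<oplus>\<^bsub>?U\<^esub> q) n = (h p \<oplus>\<^bsub>?G\<^esub> h q) n"
      using p q upD by (simp add: h_def add B_def G_def Q.a_rcos_sum)
  qed
  have hone: "h \<one>\<^bsub>?U\<^esub> = \<one>\<^bsub>?G\<^esub>" and hzero: "h \<zero>\<^bsub>?U\<^esub> = \<zero>\<^bsub>?G\<^esub>"
    by (auto simp: h_def one zero G_def coset0 fun_eq_iff numeral_eq_Suc)
  have img: "h ` B = carrier ?G"
  proof (intro equalityI subsetI)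
    fix x assume "x \<in> h ` B"
    then obtain p where p: "p \<in> B" "x = h p" by blast
    then obtain k where k: "bound \<zero> k p" by (auto simp: B_def carrier_U)
    have "n \<le> k" if "x n \<noteq> P (Suc n)" for n
      using that bound.bound[OF k, of n] coset0[of n] by (cases "k < n") (auto simp: p(2) h_def)
    then have "finite {n. x n \<noteq> P (Suc n)}" by (auto intro: finite_subset[of _ "{..k}"])
    with p show "x \<in> carrier ?G" by (auto simp: G_def h_def B_def)
  next
    fix x assume "x \<in> carrier ?G"
    then have fin: "finite {n. x n \<noteq> P (Suc n)}"
      and "\<forall>n. \<exists>a. a \<in> P n \<and> x n = P (Suc n) +> a"
      by (auto simp: G_def)
    then obtain a where a: "\<And>n. a n \<in> P n" "\<And>n. x n = P (Suc n) +> a n" by metis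
    define p where "p n = (if x n = P (Suc n) then \<zero> else a n)" for n
    from fin obtain k where "\<forall>n\<in>{n. x n \<noteq> P (Suc n)}. n \<le> k" unfolding finite_nat_set_iff_bounded_le by blast
    then have "bound \<zero> k p" by (intro bound.intro) (metis (mono_tags, lifting) mem_Collect_eq not_less p_def)
    moreover have "p n \<in> P n" for n using a zP by (simp add: p_def)
    ultimately have "p \<in> B" using carr by (auto simp: B_def carrier_U)
    moreover have "x = h p" using a coset0 by (auto simp: h_def p_def fun_eq_iff)
    ultimately show "x \<in> h ` B" by blast
  qed
  have "h \<in> ring_hom B' ?G"
    using img hmult hadd hone by (auto simp: ring_hom_def B')
  from B.ring_hom_imp_img_ring[OF this] have ring: "ring ?G"
    by (simp add: B' img hzero)
  have comm: "x \<otimes>\<^bsub>?G\<^esub> y = y \<otimes>\<^bsub>?G\<^esub> x" if "x \<in> carrier ?G" "y \<in> carrier ?G" for x y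
  proof -
    from that obtain p q where pq: "p \<in> B" "q \<in> B" "x = h p" "y = h q" unfolding img[symmetric] by blast
    have "h (p \<otimes>\<^bsub>?U\<^esub> q) = h (q \<otimes>\<^bsub>?U\<^esub> p)" using pq U.P.m_comm[of p q] by (simp add: B_def)
    then show ?thesis using pq by (simp add: hmult)
  qed
  show ?thesis
    by (intro cring.intro comm_monoid.intro comm_monoid_axioms.intro ring
        ring.is_monoid[OF ring] comm)
qed


section \<open>Numerical semigroups and their tangent cones\<close>

definition numerical_semigroup :: "nat set \<Rightarrow> bool" where
  "numerical_semigroup \<Gamma> \<longleftrightarrow> 0 \<in> \<Gamma> \<and> (\<forall>a\<in>\<Gamma>. \<forall>b\<in>\<Gamma>. a + b \<in> \<Gamma>) \<and> finite (- \<Gamma>)"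

text \<open>For a finite set \<open>A\<close> only.\<close>

definition generated_semigroup :: "nat set \<Rightarrow> nat set" where
  "generated_semigroup A = {\<Sum>a\<in>A. c a * a | c. True}"

text \<open>Every numerical semigroup has a least generating set.  It plays the role of
  \<open>a\<^sub>1 < \<dots> < a\<^sub>e\<close>; the ring and its maximal ideal below do not depend on this choice, see
  \<open>carrier_semigroup_ring\<close> and \<open>semigroup_max_ideal_eq\<close>.\<close>

definition minimal_generators :: "nat set \<Rightarrow> nat set" where
  "minimal_generators \<Gamma> =
     {a \<in> \<Gamma>. a \<noteq> 0 \<and> \<not> (\<exists>b\<in>\<Gamma>. \<exists>c\<in>\<Gamma>. b \<noteq> 0 \<and> c \<noteq> 0 \<and> a = b + c)}"

text \<open>
  \<open>K[[t\<^sup>a : a \<in> A]]\<close> for a finite set \<open>A\<close> of positive integers: all series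
  \<open>\<Sum>\<^sub>c f(c) \<Prod>\<^sub>a (t\<^sup>a)\<^sup>c\<^sup>(\<^sup>a\<^sup>)\<close>, where \<open>c\<close> ranges over the exponent vectors \<open>A \<rightarrow> \<nat>\<close>.  The coefficient
  of \<open>t\<^sup>n\<close> is the (finite) sum of the \<open>f(c)\<close> with \<open>\<Sum>\<^sub>a c(a) a = n\<close>.
\<close>

definition exponents :: "nat set \<Rightarrow> nat \<Rightarrow> (nat \<Rightarrow> nat) set" where
  "exponents A n = {c. (\<forall>a. a \<notin> A \<longrightarrow> c a = 0) \<and> (\<Sum>a\<in>A. c a * a) = n}"

definition power_series_in :: "nat set \<Rightarrow> 'k::field fps set" where
  "power_series_in A = {Abs_fps (\<lambda>n. \<Sum>c\<in>exponents A n. f c) | f. True}"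

definition semigroup_ring :: "nat set \<Rightarrow> 'k::field fps ring" where
  "semigroup_ring \<Gamma> = ring_of_type_algebra\<lparr>carrier := power_series_in (minimal_generators \<Gamma>)\<rparr>"

definition semigroup_max_ideal :: "nat set \<Rightarrow> 'k::field fps set" where
  "semigroup_max_ideal \<Gamma> = Idl\<^bsub>semigroup_ring \<Gamma>\<^esub> ((\<lambda>a. fps_X ^ a) ` minimal_generators \<Gamma>)"

definition tangent_cone :: "nat set \<Rightarrow> (nat \<Rightarrow> 'k::field fps set) ring" where
  "tangent_cone \<Gamma> = assoc_graded (semigroup_ring \<Gamma>) (semigroup_max_ideal \<Gamma>)"

definition semigroup_S4 :: "nat \<Rightarrow> nat set" where
  "semigroup_S4 n =
     generated_semigroup {n^2 + 2*n, n^2 + 2*n + 1, n^2 + 3*n + 1, n^2 + 3*n + 2}"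


subsection \<open>Independence of the generators\<close>

lemma generated_semigroup_zero: "0 \<in> generated_semigroup A"
  unfolding generated_semigroup_def by (rule CollectI, rule exI[of _ "\<lambda>_. 0"]) simp

lemma generated_semigroup_add:
  assumes "x \<in> generated_semigroup A" "y \<in> generated_semigroup A"
  shows "x + y \<in> generated_semigroup A"
proof -
  from assms obtain c d where "x = (\<Sum>a\<in>A. c a * a)" "y = (\<Sum>a\<in>A. d a * a)"
    unfolding generated_semigroup_def by blast
  then have "x + y = (\<Sum>a\<in>A. (c a + d a) * a)"
    by (simp add: sum.distrib algebra_simps)
  then show ?thesis unfolding generated_semigroup_def
    by (intro CollectI exI[of _ "\<lambda>a. c a + d a"]) simp
qed

lemma generated_semigroup_incl:
  assumes "finite A" "a \<in> A"
  shows "a \<in> generated_semigroup A"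
proof -
  have "(\<Sum>b\<in>A. (if b = a then 1 else 0) * b) = (\<Sum>b\<in>A. if b = a then b else 0)"
    by (intro sum.cong) auto
  also have "\<dots> = a" using assms by simp
  finally show ?thesis unfolding generated_semigroup_def
    by (intro CollectI exI[of _ "\<lambda>b. if b = a then 1 else 0"]) simp
qed

lemma generated_semigroup_least:
  assumes "finite A" "A \<subseteq> \<Gamma>" and 0: "0 \<in> \<Gamma>" and add: "\<And>a b. a \<in> \<Gamma> \<Longrightarrow> b \<in> \<Gamma> \<Longrightarrow> a + b \<in> \<Gamma>"
  shows "generated_semigroup A \<subseteq> \<Gamma>"
proof -
  have mult: "k * a \<in> \<Gamma>" if "a \<in> \<Gamma>" for k a
    by (induction k) (use that 0 add in auto)
  have "(\<Sum>a\<in>A. c a * a) \<in> \<Gamma>" for c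
    using assms(1,2) by (induction A rule: finite_induct) (use 0 add mult in auto)
  then show ?thesis unfolding generated_semigroup_def by blast
qed

lemma minimal_generators_subset:
  assumes "finite A"
  shows "minimal_generators (generated_semigroup A) \<subseteq> A"
proof
  fix a assume "a \<in> minimal_generators (generated_semigroup A)"
  then have a: "a \<in> generated_semigroup A" "a \<noteq> 0"
    and irr: "\<And>b c. b \<in> generated_semigroup A \<Longrightarrow> c \<in> generated_semigroup A \<Longrightarrow> a = b + c \<Longrightarrow> b = 0 \<or> c = 0"
    unfolding minimal_generators_def by auto
  from a obtain f where f: "a = (\<Sum>b\<in>A. f b * b)" unfolding generated_semigroup_def by blast
  with a have "\<not> (\<forall>b\<in>A. f b * b = 0)" using f sum.neutral[of A "\<lambda>b. f b * b"] by linarith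
  then obtain b where b: "b \<in> A" "f b * b \<noteq> 0" by blast
  define g where "g = f(b := f b - 1)"
  have "a = f b * b + (\<Sum>x\<in>A - {b}. f x * x)" using f b(1) assms by (simp add: sum.remove)
  also have "(\<Sum>x\<in>A - {b}. f x * x) = (\<Sum>x\<in>A - {b}. g x * x)"
    by (intro sum.cong) (auto simp: g_def)
  also have "f b * b = b + g b * b" using b(2) by (cases "f b") (auto simp: g_def)
  also have "b + g b * b + (\<Sum>x\<in>A - {b}. g x * x) = b + (\<Sum>x\<in>A. g x * x)"
    using b(1) assms by (simp add: sum.remove)
  finally have eq: "a = b + (\<Sum>x\<in>A. g x * x)" .
  moreover have "(\<Sum>x\<in>A. g x * x) \<in> generated_semigroup A"
    unfolding generated_semigroup_def by blast
  ultimately have "(\<Sum>x\<in>A. g x * x) = 0"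
    using irr[OF generated_semigroup_incl[OF assms b(1)]] b(2) by auto
  with eq b(1) show "a \<in> A" by simp
qed

lemma generated_by_minimal_generators:
  assumes "finite A"
  shows "generated_semigroup (minimal_generators (generated_semigroup A)) = generated_semigroup A"
    (is "generated_semigroup ?M = ?G")
proof
  have fin: "finite ?M" using minimal_generators_subset[OF assms] assms by (rule finite_subset)
  show "generated_semigroup ?M \<subseteq> ?G"
    by (rule generated_semigroup_least[OF fin])
      (auto simp: minimal_generators_def generated_semigroup_zero generated_semigroup_add)
  have "s \<in> generated_semigroup ?M" if "s \<in> ?G" for s
    using that
  proof (induction s rule: less_induct)
    case (less s)
    show ?case
    proof (cases "s = 0 \<or> s \<in> ?M")
      case True
      then show ?thesis using generated_semigroup_zero generated_semigroup_incl[OF fin] by auto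
    next
      case False
      then obtain b c where "b \<in> ?G" "c \<in> ?G" "b \<noteq> 0" "c \<noteq> 0" "s = b + c"
        using less.prems unfolding minimal_generators_def by auto
      then show ?thesis using less.IH[of b] less.IH[of c] generated_semigroup_add by auto
    qed
  qed
  then show "?G \<subseteq> generated_semigroup ?M" by blast
qed

lemma finite_exponents:
  assumes "finite A" "0 \<notin> A"
  shows "finite (exponents A n)"
proof (rule finite_subset)
  show "finite {c. \<forall>x. (x \<in> A \<longrightarrow> c x \<in> {..n}) \<and> (x \<notin> A \<longrightarrow> c x = 0)}"
    by (rule finite_set_of_finite_funs) (use assms in auto)
  show "exponents A n \<subseteq> {c. \<forall>x. (x \<in> A \<longrightarrow> c x \<in> {..n}) \<and> (x \<notin> A \<longrightarrow> c x = 0)}"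
  proof (intro subsetI CollectI allI conjI impI)
    fix c x assume c: "c \<in> exponents A n" and x: "x \<in> A"
    have "c x \<le> c x * x" using x assms by (cases x) auto
    also have "\<dots> \<le> (\<Sum>a\<in>A. c a * a)" using x assms by (intro member_le_sum) auto
    also have "\<dots> = n" using c by (simp add: exponents_def)
    finally show "c x \<in> {..n}" by simp
  qed (auto simp: exponents_def)
qed

lemma exponents_eq_empty_iff: "exponents A n = {} \<longleftrightarrow> n \<notin> generated_semigroup A"
proof -
  have "\<exists>c. c \<in> exponents A n" if n: "n = (\<Sum>a\<in>A. c a * a)" for c
  proof (intro exI)
    have "(\<Sum>a\<in>A. (if a \<in> A then c a else 0) * a) = (\<Sum>a\<in>A. c a * a)"
      by (intro sum.cong) auto
    then show "(\<lambda>a. if a \<in> A then c a else 0) \<in> exponents A n"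
      by (simp add: exponents_def n)
  qed
  moreover have "n \<in> generated_semigroup A" if "c \<in> exponents A n" for c
    using that unfolding generated_semigroup_def exponents_def by blast
  ultimately show ?thesis unfolding generated_semigroup_def by blast
qed

theorem power_series_in_eq:
  assumes "finite A" "0 \<notin> A"
  shows "power_series_in A = {F :: 'k::field fps. \<forall>n. fps_nth F n \<noteq> 0 \<longrightarrow> n \<in> generated_semigroup A}"
proof (intro equalityI subsetI CollectI allI impI)
  fix F :: "'k fps" and n assume "F \<in> power_series_in A" "fps_nth F n \<noteq> 0"
  then have "exponents A n \<noteq> {}" by (auto simp: power_series_in_def)
  then show "n \<in> generated_semigroup A" by (simp add: exponents_eq_empty_iff)
next
  fix F :: "'k fps" assume "F \<in> {F. \<forall>n. fps_nth F n \<noteq> 0 \<longrightarrow> n \<in> generated_semigroup A}"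
  then have F: "fps_nth F n = 0" if "n \<notin> generated_semigroup A" for n using that by auto
  define r where "r n = (SOME c. c \<in> exponents A n)" for n
  have r: "r n \<in> exponents A n" if "n \<in> generated_semigroup A" for n
    unfolding r_def using that by (metis exponents_eq_empty_iff some_in_eq)
  define f where "f c = (let n = \<Sum>a\<in>A. c a * a in if c = r n then fps_nth F n else 0)" for c
  have "(\<Sum>c\<in>exponents A n. f c) = fps_nth F n" for n
  proof -
    have "(\<Sum>c\<in>exponents A n. f c) = (\<Sum>c\<in>exponents A n. if c = r n then fps_nth F n else 0)"
      by (intro sum.cong) (auto simp: f_def exponents_def Let_def)
    also have "\<dots> = fps_nth F n"
      using r[of n] F[of n] finite_exponents[OF assms] by auto
    finally show ?thesis .
  qed
  then have "F = Abs_fps (\<lambda>n. \<Sum>c\<in>exponents A n. f c)" by (simp add: fps_eq_iff)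
  then show "F \<in> power_series_in A" unfolding power_series_in_def by blast
qed

text \<open>Together with \<open>power_series_in_eq\<close>: \<^const>\<open>semigroup_ring\<close> of the semigroup generated by \<open>A\<close> is
  \<open>K[[t\<^sup>a : a \<in> A]]\<close>, whether or not \<open>A\<close> is minimal.\<close>

lemma carrier_semigroup_ring:
  assumes "finite A"
  shows "carrier (semigroup_ring (generated_semigroup A)) =
           {F :: 'k::field fps. \<forall>n. fps_nth F n \<noteq> 0 \<longrightarrow> n \<in> generated_semigroup A}"
proof -
  have "finite (minimal_generators (generated_semigroup A))"
    using minimal_generators_subset[OF assms] assms by (rule finite_subset)
  moreover have "0 \<notin> minimal_generators (generated_semigroup A)"
    by (simp add: minimal_generators_def)
  ultimately show ?thesis
    unfolding semigroup_ring_def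
    by (simp add: power_series_in_eq generated_by_minimal_generators[OF assms])
qed

lemma semigroup_ring_simps:
  "x \<otimes>\<^bsub>semigroup_ring \<Gamma>\<^esub> y = x * y"
  "x \<oplus>\<^bsub>semigroup_ring \<Gamma>\<^esub> y = x + y"
  "\<one>\<^bsub>semigroup_ring \<Gamma>\<^esub> = 1"
  "\<zero>\<^bsub>semigroup_ring \<Gamma>\<^esub> = 0"
  by (simp_all add: semigroup_ring_def ring_of_type_algebra_def)

theorem cring_semigroup_ring:
  assumes "finite A"
  shows "cring (semigroup_ring (generated_semigroup A) :: 'k::field fps ring)"
proof -
  let ?R = "semigroup_ring (generated_semigroup A) :: 'k fps ring"
  note C = carrier_semigroup_ring[OF assms, where ?'k = 'k]
  have mult: "x * y \<in> carrier ?R" if "x \<in> carrier ?R" "y \<in> carrier ?R" for x y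
  proof -
    have "n \<in> generated_semigroup A" if n: "fps_nth (x * y) n \<noteq> 0" for n
    proof -
      from n have "\<not> (\<forall>i\<in>{0..n}. fps_nth x i * fps_nth y (n - i) = 0)"
        using sum.neutral[of "{0..n}" "\<lambda>i. fps_nth x i * fps_nth y (n - i)"]
        by (simp only: fps_mult_nth) blast
      then obtain i where i: "i \<le> n" "fps_nth x i * fps_nth y (n - i) \<noteq> 0" by auto
      then have "i \<in> generated_semigroup A" "n - i \<in> generated_semigroup A"
        using \<open>x \<in> carrier ?R\<close> \<open>y \<in> carrier ?R\<close> unfolding C by auto
      then have "i + (n - i) \<in> generated_semigroup A" by (rule generated_semigroup_add)
      with i show ?thesis by simp
    qed
    then show ?thesis by (simp add: C)
  qed
  have add: "x + y \<in> carrier ?R" if "x \<in> carrier ?R" "y \<in> carrier ?R" for x y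
    using that unfolding C by (auto, metis add_0)
  have neg: "- x \<in> carrier ?R" if "x \<in> carrier ?R" for x
    using that unfolding C by auto
  have one: "1 \<in> carrier ?R" using generated_semigroup_zero by (auto simp: C)
  have zero: "0 \<in> carrier ?R" by (simp add: C)
  show ?thesis
  proof (rule cringI)
    show "abelian_group ?R"
      by (rule abelian_groupI)
        (auto simp: semigroup_ring_simps add zero algebra_simps intro!: bexI[OF _ neg])
    show "comm_monoid ?R"
      by (rule comm_monoidI) (auto simp: semigroup_ring_simps mult one algebra_simps)
  qed (simp add: semigroup_ring_simps algebra_simps)
qed

text \<open>The ideal \<open>\<mm> = (t\<^sup>a : a \<in> A)\<close> consists of the series in \<open>R\<close> without constant term.\<close>

theorem semigroup_max_ideal_eq:
  assumes A: "finite A"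
  shows "semigroup_max_ideal (generated_semigroup A) =
           {F \<in> carrier (semigroup_ring (generated_semigroup A)). fps_nth F 0 = (0 :: 'k::field)}"
proof
  define G where "G = generated_semigroup A"
  define M where "M = minimal_generators G"
  define R where "R = (semigroup_ring G :: 'k fps ring)"
  define J where "J = {F \<in> carrier R. fps_nth F 0 = 0}"
  have fin: "finite M"
    unfolding M_def G_def using minimal_generators_subset[OF A] A by (rule finite_subset)
  have M: "M \<subseteq> G" "0 \<notin> M" "generated_semigroup M = G"
    unfolding M_def G_def using generated_by_minimal_generators[OF A]
    by (auto simp: minimal_generators_def)
  have C: "F \<in> carrier R \<longleftrightarrow> (\<forall>n. fps_nth F n \<noteq> 0 \<longrightarrow> n \<in> G)" for F
    using carrier_semigroup_ring[OF A] unfolding R_def G_def by blast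
  interpret R: cring R unfolding R_def G_def by (rule cring_semigroup_ring[OF A])
  have simps: "x \<otimes>\<^bsub>R\<^esub> y = x * y" "x \<oplus>\<^bsub>R\<^esub> y = x + y" "\<zero>\<^bsub>R\<^esub> = 0" for x y
    by (simp_all add: R_def semigroup_ring_simps)
  have neg: "\<ominus>\<^bsub>R\<^esub> x = - x" if "x \<in> carrier R" for x
    using R.r_neg[OF that] unfolding simps by (simp add: eq_neg_iff_add_eq_0 add.commute)
  have X: "fps_X ^ a \<in> carrier R" if "a \<in> M" for a
    using that M(1) by (auto simp: C fps_X_power_nth split: if_splits)
  have "ideal J R"
  proof (rule idealI)
    show "subgroup J (add_monoid R)"
    proof (rule R.add.subgroupI)
      show "J \<noteq> {}" using R.zero_closed by (auto simp: J_def simps)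
      show "\<ominus>\<^bsub>R\<^esub> x \<in> J" if "x \<in> J" for x
        using that R.a_inv_closed[of x] by (simp add: J_def neg)
      show "x \<oplus>\<^bsub>R\<^esub> y \<in> J" if "x \<in> J" "y \<in> J" for x y
        using that R.a_closed[of x y] by (simp add: J_def simps)
    qed (auto simp: J_def)
    show "y \<otimes>\<^bsub>R\<^esub> x \<in> J" "x \<otimes>\<^bsub>R\<^esub> y \<in> J" if "x \<in> J" "y \<in> carrier R" for x y
      using that R.m_closed[of x y] R.m_closed[of y x] by (simp_all add: J_def simps)
  qed (rule R.ring_axioms)
  moreover have "(\<lambda>a. fps_X ^ a) ` M \<subseteq> J"
  proof
    fix x :: "'k fps" assume "x \<in> (\<lambda>a. fps_X ^ a) ` M"
    then obtain a where a: "a \<in> M" "x = fps_X ^ a" by blast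
    then have "a \<noteq> 0" using M(2) by metis
    then show "x \<in> J" using a X by (simp add: J_def fps_X_power_nth)
  qed
  ultimately have sub: "Idl\<^bsub>R\<^esub> ((\<lambda>a. fps_X ^ a) ` M) \<subseteq> J" by (rule R.genideal_minimal)
  interpret I: ideal "Idl\<^bsub>R\<^esub> ((\<lambda>a. fps_X ^ a) ` M)" R
    by (rule R.genideal_ideal) (use X in blast)
  have gen: "fps_X ^ a \<in> Idl\<^bsub>R\<^esub> ((\<lambda>a. fps_X ^ a) ` M)" if "a \<in> M" for a
    using R.genideal_self[of "(\<lambda>a. fps_X ^ a) ` M"] X that by blast
  have sup: "F \<in> Idl\<^bsub>R\<^esub> ((\<lambda>a. fps_X ^ a) ` M)" if F: "F \<in> J" for F
  proof -
    have "\<exists>a\<in>M. a \<le> n \<and> n - a \<in> G" if n: "n \<in> G" "n \<noteq> 0" for n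
    proof -
      have "n \<in> {n. n \<in> G \<and> (n = 0 \<or> (\<exists>a\<in>M. a \<le> n \<and> n - a \<in> G))}" (is "n \<in> ?S")
      proof -
        have "generated_semigroup M \<subseteq> ?S"
        proof (rule generated_semigroup_least[OF fin])
          have 0: "0 \<in> G" unfolding G_def by (rule generated_semigroup_zero)
          then show "0 \<in> ?S" by simp
          show "M \<subseteq> ?S" using M(1) 0 by force
          fix x y assume x: "x \<in> ?S" and y: "y \<in> ?S"
          then have xy: "x + y \<in> G" unfolding G_def using generated_semigroup_add by blast
          show "x + y \<in> ?S"
          proof (cases "x = 0")
            case True
            with y show ?thesis by simp
          next
            case False
            with x obtain a where a: "a \<in> M" "a \<le> x" "x - a \<in> G" by blast
            with y have "(x - a) + y \<in> G" unfolding G_def using generated_semigroup_add by blast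
            with a xy have "a \<in> M \<and> a \<le> x + y \<and> x + y - a \<in> G" by simp
            with xy show ?thesis by blast
          qed
        qed
        with n M(3) show ?thesis by blast
      qed
      with n show ?thesis by blast
    qed
    then obtain g where g: "\<And>n. n \<in> G \<Longrightarrow> n \<noteq> 0 \<Longrightarrow> g n \<in> M \<and> g n \<le> n \<and> n - g n \<in> G"
      by metis
    define H where "H a = Abs_fps (\<lambda>k. if k \<in> G \<and> g (k + a) = a then fps_nth F (k + a) else 0)" for a
    have H: "H a \<in> carrier R" for a by (auto simp: C H_def)
    have "F = (\<Sum>a\<in>M. fps_X ^ a * H a)"
    proof (rule fps_ext)
      fix n
      have "fps_nth (\<Sum>a\<in>M. fps_X ^ a * H a) n =
              (\<Sum>a\<in>M. if n < a then 0 else fps_nth (H a) (n - a))"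
        by (simp add: fps_sum_nth fps_X_power_mult_nth)
      also have "\<dots> = fps_nth F n"
      proof (cases "n \<in> G \<and> n \<noteq> 0")
        case True
        then have "(\<Sum>a\<in>M. if n < a then 0 else fps_nth (H a) (n - a)) =
                     (\<Sum>a\<in>M. if a = g n then fps_nth F n else 0)"
          using g[of n] by (intro sum.cong) (auto simp: H_def)
        then show ?thesis using g[of n] True fin by simp
      next
        case False
        then have "fps_nth F n = 0" using F C[of F] unfolding J_def by auto
        moreover from this have "(\<Sum>a\<in>M. if n < a then 0 else fps_nth (H a) (n - a)) = 0"
          by (intro sum.neutral) (auto simp: H_def)
        ultimately show ?thesis by simp
      qed
      finally show "fps_nth F n = fps_nth (\<Sum>a\<in>M. fps_X ^ a * H a) n" by simp
    qed
    moreover have "(\<Sum>a\<in>N. fps_X ^ a * H a) \<in> Idl\<^bsub>R\<^esub> ((\<lambda>a. fps_X ^ a) ` M)"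
      if "finite N" "N \<subseteq> M" for N
      using that
    proof (induction N rule: finite_induct)
      case empty
      show ?case using I.zero_closed by (simp add: simps)
    next
      case (insert a N)
      then have "fps_X ^ a * H a \<in> Idl\<^bsub>R\<^esub> ((\<lambda>a. fps_X ^ a) ` M)"
        using I.I_r_closed[OF gen H, of a a] by (simp add: simps)
      with insert show ?case using I.a_closed by (simp add: simps)
    qed
    ultimately show ?thesis using fin by simp
  qed
  show "semigroup_max_ideal (generated_semigroup A) \<subseteq>
          {F \<in> carrier (semigroup_ring (generated_semigroup A)). fps_nth F 0 = (0 :: 'k)}"
    using sub unfolding semigroup_max_ideal_def J_def R_def M_def G_def .
  show "{F \<in> carrier (semigroup_ring (generated_semigroup A)). fps_nth F 0 = (0 :: 'k)} \<subseteq>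
          semigroup_max_ideal (generated_semigroup A)"
    using sup unfolding semigroup_max_ideal_def J_def R_def M_def G_def by blast
qed

lemma numerical_semigroup_S4:
  assumes "n \<ge> 1"
  shows "numerical_semigroup (semigroup_S4 n)"
proof -
  define m where "m = n^2 + 2*n"
  have m0: "m > 0" using assms by (simp add: m_def)
  let ?A = "{n^2 + 2*n, n^2 + 2*n + 1, n^2 + 3*n + 1, n^2 + 3*n + 2}"
  have m: "m \<in> semigroup_S4 n" "m + 1 \<in> semigroup_S4 n"
    unfolding semigroup_S4_def m_def by (rule generated_semigroup_incl; simp)+
  have add: "a + b \<in> semigroup_S4 n" if "a \<in> semigroup_S4 n" "b \<in> semigroup_S4 n" for a b
    using that unfolding semigroup_S4_def by (rule generated_semigroup_add)
  have 0: "0 \<in> semigroup_S4 n" unfolding semigroup_S4_def by (rule generated_semigroup_zero)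
  have mult: "k * a \<in> semigroup_S4 n" if "a \<in> semigroup_S4 n" for k a
    by (induction k) (use that 0 add in auto)
  have "N \<in> semigroup_S4 n" if N: "N \<ge> m * m" for N
  proof -
    have "N mod m < m" using m0 by simp
    moreover have "m \<le> N div m" using N m0 by (simp add: less_eq_div_iff_mult_less_eq)
    ultimately have le: "N mod m \<le> N div m" by simp
    have "(N div m - N mod m) * m + N mod m * (m + 1) = (N div m - N mod m + N mod m) * m + N mod m"
      by (simp add: distrib_right distrib_left)
    also have "\<dots> = N" using le by simp
    finally show ?thesis using add[OF mult[OF m(1)] mult[OF m(2)]] by metis
  qed
  then have "- semigroup_S4 n \<subseteq> {..<m * m}" by (auto simp: not_less[symmetric])
  then have "finite (- semigroup_S4 n)" by (rule finite_subset) simp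
  with 0 add show ?thesis by (simp add: numerical_semigroup_def)
qed

lemma minimal_generators_S4:
  assumes "n \<ge> 2"
  shows "minimal_generators (semigroup_S4 n) = {n^2 + 2*n, n^2 + 2*n + 1, n^2 + 3*n + 1, n^2 + 3*n + 2}"
    (is "_ = ?A")
proof
  show "minimal_generators (semigroup_S4 n) \<subseteq> ?A"
    unfolding semigroup_S4_def by (rule minimal_generators_subset) simp
  have sq: "2 * n \<le> n^2" using assms by (simp add: power2_eq_square)
  have "semigroup_S4 n \<subseteq> {s. s = 0 \<or> s \<ge> n^2 + 2*n}"
    unfolding semigroup_S4_def by (rule generated_semigroup_least) auto
  then have ge: "s \<ge> n^2 + 2*n" if "s \<in> semigroup_S4 n" "s \<noteq> 0" for s using that by auto
  show "?A \<subseteq> minimal_generators (semigroup_S4 n)"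
  proof
    fix a assume a: "a \<in> ?A"
    then have "a \<in> semigroup_S4 n" unfolding semigroup_S4_def by (rule generated_semigroup_incl[rotated]) simp
    moreover have "a \<noteq> 0" "a < 2 * (n^2 + 2*n)" using a sq assms by auto
    moreover have "a \<noteq> b + c" if "b \<in> semigroup_S4 n" "c \<in> semigroup_S4 n" "b \<noteq> 0" "c \<noteq> 0" for b c
      using ge[OF that(1,3)] ge[OF that(2,4)] \<open>a < 2 * (n^2 + 2*n)\<close> by auto
    ultimately show "a \<in> minimal_generators (semigroup_S4 n)"
      unfolding minimal_generators_def by blast
  qed
qed

end

theory Submission
  imports Defs
begin

text \<open>
  The tangent cone has one basis element \<open>e\<^sub>s\<close> for each \<open>s\<close> in the semigroup, in degree \<open>ord s\<close>, the
  largest number of generators that add up to \<open>s\<close>; and \<open>e\<^sub>u e\<^sub>v\<close> is \<open>e\<^sub>u\<^sub>+\<^sub>v\<close> or zero according to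
  whether \<open>ord (u + v) = ord u + ord v\<close>.  Let \<open>m\<close> be the least generator and \<open>x = e\<^sub>m\<close>.  If
  \<open>ord (s + m) = ord s + 1\<close> for all \<open>s\<close>, then \<open>x\<close> is a nonzerodivisor, and the tangent cone is
  Cohen-Macaulay (\<open>Cohen_Macaulay_tangent_cone\<close>).

  Cohen-Macaulayness is required at every maximal ideal, homogeneous or not.  This is
  manageable because the tangent cone modulo its nilpotent elements is just \<open>K[x]\<close>.  Indeed, the defect
  \<open>s - m ord s\<close> is nonnegative, is additive on nonzero products of basis elements, is bounded because it
  is invariant under adding \<open>m\<close>, and vanishes only for multiples of \<open>m\<close>.  So the basis elements outside
  \<open>K[x]\<close> span a nilpotent ideal, and by looking at the part of least defect every element outside that ideal is a
  nonzerodivisor.  For a Noetherian ring with these two properties, depth and height of every maximal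
  ideal are one (\<open>polynomial_reduction.Cohen_Macaulay_if_noetherian\<close>); the Noetherian property comes from the
  tangent cone being finite over \<open>K[x]\<close>.

  The condition on orders is a computation with the given generators, which are
  \<open>m + i + j(n + 1)\<close> for \<open>i, j \<in> {0, 1}\<close>, where \<open>m = (n + 1)\<^sup>2 - 1\<close>.  Sums of \<open>l\<close> generators are thus
  \<open>lm + i + j(n + 1)\<close> with \<open>0 \<le> i, j \<le> l\<close>, and the question whether a summand \<open>m\<close> can be cancelled is settled
  by trading multiples of \<open>1\<close>, \<open>n + 1\<close> and \<open>(n + 1)\<^sup>2\<close> against each other (\<open>grid_descent\<close>).
\<close>


section \<open>Rings whose reduction is a polynomial ring in one variable\<close>

lemma (in cring) Idl_singleton: "a \<in> carrier R \<Longrightarrow> Idl {a} = PIdl a"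
  by (simp add: cgenideal_eq_genideal)

lemma (in ring) Idl_empty: "Idl {} = {\<zero>}"
  using genideal_minimal[OF zeroideal, of "{}"] additive_subgroup.zero_closed[OF ideal.axioms(1)[OF genideal_ideal[of "{}"]]]
  by auto

text \<open>Splitting off from \<open>a\<close> all factors \<open>q\<close>, one at a time, leaves a polynomial \<open>g\<close> not divisible by \<open>q\<close>; the
degree bounds the number of factors.  In geometric terms, away from the zeros of \<open>g\<close> some power of
\<open>q\<close> lies in the ideal generated by \<open>a\<close>.\<close>

lemma power_of_nonunit_absorbs:
  fixes q a :: "'k::field poly"
  assumes q: "q \<noteq> 0" "\<not> q dvd 1" and a: "a \<noteq> 0"
  shows "\<exists>g k. \<not> q dvd g \<and> a dvd g * q ^ k"
  using a
proof (induction "Polynomial.degree a" arbitrary: a rule: less_induct)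
  case less
  show ?case
  proof (cases "q dvd a")
    case False
    then show ?thesis by (intro exI[of _ a] exI[of _ 0]) auto
  next
    case True
    then obtain b where b: "a = q * b" by blast
    have "Polynomial.degree q \<noteq> 0" using q by (metis is_unit_iff_degree)
    then have "Polynomial.degree b < Polynomial.degree a" "b \<noteq> 0"
      using less.prems b by (auto simp: degree_mult_eq)
    then obtain g k where gk: "\<not> q dvd g" "b dvd g * q ^ k" using less.hyps by blast
    then have "a dvd g * q ^ Suc k" using b mult_dvd_mono[of q q b "g * q ^ k"] by (simp add: ac_simps)
    then show ?thesis using gk(1) by blast
  qed
qed

text \<open>The situation of a tangent cone that is free over the polynomial ring in its parameter: modulo
nilpotent elements the ring is \<open>K[x]\<close>, and the only zero divisors are the nilpotent elements.  The
primes of such a ring are those of \<open>K[x]\<close>, so its dimension is one, and depth one is visible from any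
element of a maximal ideal outside the kernel.\<close>

locale polynomial_reduction = cring R for R (structure) +
  fixes \<pi> :: "'a \<Rightarrow> 'k::field poly"
  assumes hom_add: "\<lbrakk>x \<in> carrier R; y \<in> carrier R\<rbrakk> \<Longrightarrow> \<pi> (x \<oplus> y) = \<pi> x + \<pi> y"
    and hom_mult: "\<lbrakk>x \<in> carrier R; y \<in> carrier R\<rbrakk> \<Longrightarrow> \<pi> (x \<otimes> y) = \<pi> x * \<pi> y"
    and hom_one: "\<pi> \<one> = 1"
    and hom_surj: "\<exists>x\<in>carrier R. \<pi> x = p"
    and kernel_nilpotent: "\<lbrakk>x \<in> carrier R; \<pi> x = 0\<rbrakk> \<Longrightarrow> \<exists>k::nat. x [^] k = \<zero>"
    and regular_off_kernel: "\<lbrakk>x \<in> carrier R; \<pi> x \<noteq> 0; y \<in> carrier R; x \<otimes> y = \<zero>\<rbrakk> \<Longrightarrow> y = \<zero>"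
begin

lemma hom_zero: "\<pi> \<zero> = 0"
  using hom_add[OF zero_closed zero_closed] by (metis add_cancel_right_right r_zero zero_closed)

lemma hom_minus:
  assumes "x \<in> carrier R" "y \<in> carrier R"
  shows "\<pi> (x \<ominus> y) = \<pi> x - \<pi> y"
proof -
  have "\<pi> (x \<ominus> y) + \<pi> y = \<pi> ((x \<ominus> y) \<oplus> y)" using assms by (simp add: hom_add)
  also have "(x \<ominus> y) \<oplus> y = x" using assms by algebra
  finally show ?thesis by (simp add: algebra_simps)
qed

lemma hom_pow: "x \<in> carrier R \<Longrightarrow> \<pi> (x [^] (k::nat)) = \<pi> x ^ k"
  by (induction k) (simp_all add: hom_one hom_mult mult.commute)

definition ker_pi :: "'a set" where
  "ker_pi = {x \<in> carrier R. \<pi> x = 0}"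

lemma ideal_vimage:
  "ideal {x \<in> carrier R. q dvd \<pi> x} R"
proof (rule idealI)
  show "subgroup {x \<in> carrier R. q dvd \<pi> x} (add_monoid R)"
  proof (rule add.subgroupI)
    fix x assume x: "x \<in> {x \<in> carrier R. q dvd \<pi> x}"
    have "\<pi> (\<ominus> x) = \<pi> (\<zero> \<ominus> x)" using x by (simp add: minus_eq)
    then show "\<ominus> x \<in> {x \<in> carrier R. q dvd \<pi> x}" using x by (simp add: hom_minus hom_zero)
  qed (auto simp: hom_add hom_zero)
qed (auto simp: hom_mult ring_axioms)

lemma pow_in_prime:
  assumes "primeideal P R" "x \<in> carrier R" "x [^] (k::nat) \<in> P"
  shows "x \<in> P"
  using assms(3)
proof (induction k)
  case 0
  interpret P: primeideal P R by fact
  from 0 show ?case using P.one_imp_carrier assms(2) by simp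
next
  case (Suc k)
  interpret P: primeideal P R by fact
  from Suc show ?case using P.I_prime[of "x [^] k" x] assms(2) by auto
qed

text \<open>A prime contains every nilpotent element, in particular the kernel of \<open>\<pi>\<close>.  It is therefore determined by
its image in the polynomial ring.\<close>

lemma prime_cong:
  assumes P: "primeideal P R" and "x \<in> carrier R" "y \<in> P" "\<pi> x = \<pi> y"
  shows "x \<in> P"
proof -
  interpret P: primeideal P R by fact
  have y: "y \<in> carrier R" using P.Icarr assms(3) .
  then obtain k :: nat where "(x \<ominus> y) [^] k = \<zero>"
    using kernel_nilpotent[of "x \<ominus> y"] assms(2,4) hom_minus by auto
  then have "x \<ominus> y \<in> P"
    using pow_in_prime[OF P, of "x \<ominus> y" k] assms(2) y P.zero_closed by simp
  then have "(x \<ominus> y) \<oplus> y \<in> P" using assms(3) by (rule P.a_closed)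
  moreover have "(x \<ominus> y) \<oplus> y = x" using assms(2) y by algebra
  ultimately show ?thesis by simp
qed

lemma kernel_subset_prime:
  assumes "primeideal P R"
  shows "ker_pi \<subseteq> P"
proof
  interpret P: primeideal P R by fact
  fix x assume "x \<in> ker_pi"
  then show "x \<in> P" using prime_cong[OF assms, of x \<zero>] P.zero_closed by (auto simp: ker_pi_def hom_zero)
qed

lemma kernel_prime: "primeideal ker_pi R"
proof (rule primeidealI)
  have "ker_pi = {x \<in> carrier R. 0 dvd \<pi> x}" by (simp add: ker_pi_def)
  then show "ideal ker_pi R" using ideal_vimage[of 0] by simp
  show "carrier R \<noteq> ker_pi" 
  proof
    assume "carrier R = ker_pi"
    then have "\<one> \<in> ker_pi" using one_closed by blast
    then show False by (simp add: ker_pi_def hom_one)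
  qed
qed (auto simp: ker_pi_def hom_mult is_cring)

text \<open>The image of \<open>P\<close> is a nonzero prime ideal of a principal ideal domain.  The generator \<open>q\<close> is an
element of least degree in it, by division with remainder.\<close>

lemma prime_generator:
  assumes P: "primeideal P R" and ne: "P \<noteq> ker_pi"
  obtains q where "q \<noteq> 0" "P = {x \<in> carrier R. q dvd \<pi> x}"
    "\<And>u v. q dvd u * v \<Longrightarrow> q dvd u \<or> q dvd v" "\<not> q dvd 1"
proof -
  interpret P: primeideal P R by fact
  have "\<exists>x. x \<in> P \<and> \<pi> x \<noteq> 0"
    using ne kernel_subset_prime[OF P] P.a_subset by (auto simp: ker_pi_def)
  then obtain x where x: "x \<in> P" "\<pi> x \<noteq> 0"
    and min: "\<And>y. y \<in> P \<and> \<pi> y \<noteq> 0 \<Longrightarrow> Polynomial.degree (\<pi> x) \<le> Polynomial.degree (\<pi> y)"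
    using ex_has_least_nat[of "\<lambda>x. x \<in> P \<and> \<pi> x \<noteq> 0" _ "\<lambda>x. Polynomial.degree (\<pi> x)"] by blast
  define q where "q = \<pi> x"
  have xc: "x \<in> carrier R" using P.Icarr x(1) .
  have dvd: "q dvd \<pi> y" if y: "y \<in> P" for y
  proof -
    have yc: "y \<in> carrier R" using P.Icarr y .
    obtain d where d: "d \<in> carrier R" "\<pi> d = \<pi> y div q" using hom_surj by blast
    have "y \<ominus> d \<otimes> x \<in> P"
      using y x(1) d(1) P.I_l_closed P.a_closed P.a_inv_closed unfolding minus_eq by blast
    moreover have "\<pi> (y \<ominus> d \<otimes> x) = \<pi> y mod q"
      using yc xc d by (simp add: hom_minus hom_mult q_def minus_div_mult_eq_mod)
    ultimately have "\<pi> y mod q = 0 \<or> Polynomial.degree q \<le> Polynomial.degree (\<pi> y mod q)"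
      using min[of "y \<ominus> d \<otimes> x"] by (auto simp: q_def)
    then show ?thesis
      using degree_mod_less[of q "\<pi> y"] x(2) by (auto simp: q_def dvd_eq_mod_eq_0)
  qed
  have mem: "y \<in> P" if y: "y \<in> carrier R" "q dvd \<pi> y" for y
  proof -
    from y(2) obtain e where e: "\<pi> y = q * e" by blast
    obtain d where d: "d \<in> carrier R" "\<pi> d = e" using hom_surj by blast
    have "x \<otimes> d \<in> P" using x(1) d(1) by (rule P.I_r_closed)
    then show ?thesis using prime_cong[OF P y(1)] d xc e by (simp add: hom_mult q_def)
  qed
  have eq: "P = {x \<in> carrier R. q dvd \<pi> x}" using dvd mem P.Icarr by blast
  show ?thesis
  proof
    show "q \<noteq> 0" using x by (simp add: q_def)
    show "P = {x \<in> carrier R. q dvd \<pi> x}" by (rule eq)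
    show "\<not> q dvd 1"
    proof
      assume "q dvd 1"
      then have "\<one> \<in> P" using mem[of \<one>] by (simp add: hom_one)
      then show False using P.one_imp_carrier P.I_notcarr by simp
    qed
    fix u v assume uv: "q dvd u * v"
    obtain a b where ab: "a \<in> carrier R" "\<pi> a = u" "b \<in> carrier R" "\<pi> b = v" using hom_surj by metis
    then have "a \<otimes> b \<in> P" using mem uv by (simp add: hom_mult)
    then show "q dvd u \<or> q dvd v" using P.I_prime ab dvd by blast
  qed
qed

text \<open>The ideal of all elements whose image is divisible by \<open>x\<close> lies strictly between the kernel and the
whole ring.\<close>

lemma maximal_neq_kernel:
  assumes "maximalideal P R"
  shows "P \<noteq> ker_pi"
proof
  assume P: "P = ker_pi"
  interpret P: maximalideal P R by fact
  define x :: "'k poly" where "x = [:0, 1:]"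
  define J where "J = {y \<in> carrier R. x dvd \<pi> y}"
  have "J = P \<or> J = carrier R"
  proof (rule P.I_maximal)
    show "ideal J R" unfolding J_def by (rule ideal_vimage)
    show "P \<subseteq> J" unfolding P J_def ker_pi_def using dvd_0_right by auto
    show "J \<subseteq> carrier R" unfolding J_def by blast
  qed
  moreover have "\<not> x dvd 1" using is_unit_iff_degree[of x] by (simp add: x_def)
  then have "\<one> \<notin> J" by (simp add: J_def hom_one)
  moreover obtain y where "y \<in> carrier R" "\<pi> y = x" using hom_surj by blast
  then have "y \<in> J" "y \<notin> P" unfolding J_def P ker_pi_def by (simp_all add: x_def)
  ultimately show False by auto
qed

text \<open>Above the kernel, inclusions between primes are divisibilities between prime polynomials, and those
are trivial.  Hence the kernel followed by \<open>P\<close> is a longest chain.\<close>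

lemma height_maximal:
  assumes P: "maximalideal P R"
  shows "height R P = 1"
proof (rule antisym)
  have prime: "primeideal P R" using maximalideal_prime[OF P] .
  have "enat (length [ker_pi, P] - 1) \<le> height R P"
    unfolding height_def
    using kernel_prime prime kernel_subset_prime[OF prime] maximal_neq_kernel[OF P]
    by (intro SUP_upper) auto
  then show "1 \<le> height R P" by (simp add: one_enat_def)
  show "height R P \<le> 1"
    unfolding height_def
  proof (rule SUP_least, clarify)
    fix Ps assume Ps: "Ps \<noteq> []" "\<forall>Q\<in>set Ps. primeideal Q R" "sorted_wrt (\<subset>) Ps"
    show "enat (length Ps - 1) \<le> 1"
    proof (rule ccontr)
      assume "\<not> ?thesis"
      then have len: "length Ps > 2" by (auto simp: one_enat_def)
      then have prm: "primeideal (Ps ! i) R" if "i \<le> 2" for i using Ps(2) that by simp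
      have sub: "Ps ! 0 \<subset> Ps ! 1" "Ps ! 1 \<subset> Ps ! 2"
        using len Ps(3) by (auto simp: sorted_wrt_iff_nth_less)
      have ne: "Ps ! 1 \<noteq> ker_pi" "Ps ! 2 \<noteq> ker_pi"
        using sub kernel_subset_prime[OF prm, of 0] kernel_subset_prime[OF prm, of 1] by auto
      obtain p where p: "p \<noteq> 0" "Ps ! 1 = {x \<in> carrier R. p dvd \<pi> x}"
        "\<And>u v. p dvd u * v \<Longrightarrow> p dvd u \<or> p dvd v"
        using prime_generator[OF prm[of 1] ne(1)] by (metis one_le_numeral)
      obtain q where q: "Ps ! 2 = {x \<in> carrier R. q dvd \<pi> x}" "\<not> q dvd 1"
        using prime_generator[OF prm[of 2] ne(2)] by (metis order_refl)
      obtain a where "a \<in> carrier R" "\<pi> a = p" using hom_surj by blast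
      with p sub(2) have "q dvd p" by (auto simp: q)
      then obtain c where c: "p = q * c" by blast
      have "\<not> p dvd q"
      proof
        assume "p dvd q"
        then have "Ps ! 2 \<subseteq> Ps ! 1" using p(2) q(1) by (auto intro: dvd_trans)
        with sub(2) show False by blast
      qed
      then have "p dvd c" using p(3)[of q c] c by auto
      then obtain e where "c = p * e" by blast
      with c have "p * (q * e) = p * 1" by (simp add: ac_simps)
      then have "q * e = 1" using p(1) by (metis mult_cancel_left)
      with q(2) show False by (metis dvd_triv_left)
    qed
  qed
qed

lemma regular_singleton:
  assumes P: "maximalideal P R" and a: "a \<in> P" "\<pi> a \<noteq> 0"
  shows "regular_sequence R [a]"
proof -
  interpret P: maximalideal P R by fact
  have ac: "a \<in> carrier R" using P.Icarr a(1) .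
  have "Idl {a} \<subseteq> P" using genideal_minimal[OF P.is_ideal] a by simp
  then have "Idl {a} \<noteq> carrier R" using P.I_notcarr P.a_subset by blast
  then show ?thesis
    using regular_off_kernel[OF ac a(2)] ac by (auto simp: regular_sequence_def Idl_empty)
qed

text \<open>Let \<open>a, b\<close> be the first two elements of a regular sequence in \<open>P\<close>, and let \<open>q\<close> generate the image of
\<open>P\<close>.  Since \<open>P\<close> is minimal over \<open>(a)\<close>, some \<open>G \<notin> P\<close> multiplies a power of \<open>b\<close> into \<open>(a)\<close>.  As \<open>b\<close> is a
nonzerodivisor modulo \<open>(a)\<close>, this forces \<open>G \<in> (a) \<subseteq> P\<close>, a contradiction.  The relation is first
obtained for the images, where it only concerns polynomials; it lifts to the ring up to a nilpotent
summand, which a further power removes.\<close>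

lemma regular_sequence_length:
  assumes P: "maximalideal P R" and xs: "regular_sequence R xs" "set xs \<subseteq> P"
  shows "length xs \<le> 1"
proof (rule ccontr)
  assume "\<not> ?thesis"
  then have len: "length xs > 1" by simp
  interpret P: maximalideal P R by fact
  have prime: "primeideal P R" using maximalideal_prime[OF P] .
  define a b where "a = xs ! 0" and "b = xs ! 1"
  have ab: "a \<in> P" "b \<in> P" unfolding a_def b_def by (rule subsetD[OF xs(2) nth_mem], use len in linarith)+
  then have abc: "a \<in> carrier R" "b \<in> carrier R" using P.Icarr by blast+
  have reg: "\<forall>i<length xs. \<forall>y\<in>carrier R. xs ! i \<otimes> y \<in> Idl (set (take i xs)) \<longrightarrow> y \<in> Idl (set (take i xs))"
    using xs(1) by (simp add: regular_sequence_def)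
  have take1: "take 1 xs = [a]" using len by (cases xs) (auto simp: a_def)
  have rega: "y = \<zero>" if "y \<in> carrier R" "a \<otimes> y = \<zero>" for y
    using reg[rule_format, of 0 y] order.strict_trans[OF zero_less_one len] that by (auto simp: a_def Idl_empty)
  have regb: "y \<in> PIdl a" if "y \<in> carrier R" "b \<otimes> y \<in> PIdl a" for y
    using reg[rule_format, of 1 y] len that take1 abc by (simp add: b_def Idl_singleton)
  interpret A: ideal "PIdl a" R using cgenideal_ideal[OF abc(1)] .
  have PA: "PIdl a \<subseteq> P" using cgenideal_minimal[OF P.is_ideal ab(1)] .
  have "\<pi> a \<noteq> 0"
  proof
    assume "\<pi> a = 0"
    then obtain k :: nat where "a [^] k = \<zero>" using kernel_nilpotent abc by blast
    then have "\<one> = \<zero>"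
    proof (induction k)
      case (Suc k)
      then show ?case using rega[of "a [^] k"] abc by (simp add: m_comm)
    qed simp
    then show False using P.one_imp_carrier P.I_notcarr P.zero_closed by auto
  qed
  obtain q where q: "q \<noteq> 0" "P = {x \<in> carrier R. q dvd \<pi> x}"
    "\<And>u v. q dvd u * v \<Longrightarrow> q dvd u \<or> q dvd v" "\<not> q dvd 1"
    using prime_generator[OF prime maximal_neq_kernel[OF P]] by blast
  obtain g k where gk: "\<not> q dvd g" "\<pi> a dvd g * q ^ k"
    using power_of_nonunit_absorbs[OF q(1,4) \<open>\<pi> a \<noteq> 0\<close>] by blast
  then obtain c where c: "g * q ^ k = \<pi> a * c" by blast
  obtain e where e: "\<pi> b = q * e" using ab(2) q(2) by blast
  obtain G where G: "G \<in> carrier R" "\<pi> G = g" using hom_surj by blast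
  obtain C where C: "C \<in> carrier R" "\<pi> C = c * e ^ k" using hom_surj by blast
  \<comment> \<open>\<open>v\<close> is the nilpotent error in the lifted relation; \<open>u\<close> and \<open>v\<close> agree modulo \<open>(a)\<close>, hence so do
    their powers, and a power of \<open>v\<close> vanishes.\<close>
  define u where "u = G \<otimes> b [^] k"
  define v where "v = u \<ominus> C \<otimes> a"
  have uv: "u \<in> carrier R" "v \<in> carrier R" using G C abc by (auto simp: u_def v_def)
  have "\<pi> u = g * (q * e) ^ k" using G abc e by (simp add: u_def hom_mult hom_pow)
  also have "\<dots> = (g * q ^ k) * e ^ k" by (simp add: power_mult_distrib ac_simps)
  also have "\<dots> = \<pi> (C \<otimes> a)" using C abc by (simp add: c hom_mult ac_simps)
  finally have "\<pi> v = 0" using uv C abc by (simp add: v_def hom_minus)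
  then obtain j :: nat where j: "v [^] j = \<zero>" using kernel_nilpotent uv by blast
  have telescope: "x \<otimes> y \<ominus> z \<otimes> w = (x \<ominus> z) \<otimes> y \<oplus> z \<otimes> (y \<ominus> w)"
    if "x \<in> carrier R" "z \<in> carrier R" "y \<in> carrier R" "w \<in> carrier R" for x z y w
    using that by algebra
  have "u [^] i \<ominus> v [^] i \<in> PIdl a" for i :: nat
  proof (induction i)
    case 0
    show ?case by (simp add: minus_eq r_neg)
  next
    case (Suc i)
    have "u [^] Suc i \<ominus> v [^] Suc i = (u [^] i \<ominus> v [^] i) \<otimes> u \<oplus> v [^] i \<otimes> (u \<ominus> v)"
      using telescope[of "u [^] i" "v [^] i" u v] uv by simp
    moreover have "u \<ominus> v = C \<otimes> a" using uv C abc unfolding v_def by algebra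
    then have "u \<ominus> v \<in> PIdl a" using C cgenideal_self[OF abc(1)] A.I_l_closed by simp
    ultimately show ?case using Suc uv A.I_l_closed A.I_r_closed A.a_closed by simp
  qed
  from this[of j] have "u [^] j \<in> PIdl a" using j uv by (simp add: minus_eq)
  moreover have "u [^] j = b [^] (k * j) \<otimes> G [^] j"
    using G abc by (simp add: u_def nat_pow_distrib nat_pow_pow m_comm)
  ultimately have bG: "b [^] (k * j) \<otimes> G [^] j \<in> PIdl a" by simp
  have cancel: "y \<in> PIdl a" if "b [^] i \<otimes> y \<in> PIdl a" "y \<in> carrier R" for i :: nat and y
    using that
  proof (induction i)
    case (Suc i)
    have "b \<otimes> (b [^] i \<otimes> y) \<in> PIdl a"
      using Suc.prems abc m_lcomm[of b "b [^] i" y] m_assoc[of "b [^] i" b y] by simp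
    then have "b [^] i \<otimes> y \<in> PIdl a" by (rule regb[rotated]) (use Suc.prems(2) abc in simp)
    then show ?case using Suc.prems(2) by (rule Suc.IH)
  qed simp
  have "G [^] j \<in> PIdl a" using G by (intro cancel[OF bG]) simp
  with PA have "G \<in> P" by (intro pow_in_prime[OF prime G(1), of j]) (rule subsetD)
  then have "q dvd \<pi> G" by (subst (asm) q(2)) blast
  with gk(1) G(2) show False by simp
qed

lemma depth_maximal:
  assumes P: "maximalideal P R"
  shows "ideal_depth R P = 1"
proof (rule antisym)
  interpret P: maximalideal P R by fact
  have "\<exists>x. x \<in> P \<and> \<pi> x \<noteq> 0"
    using maximal_neq_kernel[OF P] kernel_subset_prime[OF maximalideal_prime[OF P]] P.a_subset
    by (auto simp: ker_pi_def)
  then obtain a where a: "a \<in> P" "\<pi> a \<noteq> 0" by blast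
  have "enat (length [a]) \<le> ideal_depth R P"
    unfolding ideal_depth_def using regular_singleton[OF P a] a(1) by (intro SUP_upper) auto
  then show "1 \<le> ideal_depth R P" by (simp add: one_enat_def)
  show "ideal_depth R P \<le> 1"
    unfolding ideal_depth_def
    by (rule SUP_least) (use regular_sequence_length[OF P] in \<open>auto simp: one_enat_def\<close>)
qed

theorem Cohen_Macaulay_if_noetherian:
  assumes "noetherian_ring R"
  shows "Cohen_Macaulay R"
  using assms depth_maximal height_maximal is_cring by (simp add: Cohen_Macaulay_def)

end


section \<open>The order function of a finitely generated semigroup\<close>

text \<open>The \<open>k\<close>-fold sumset of the maximal ideal of the semigroup: the elements that are sums of at least \<open>k\<close>
generators.\<close>

primrec semigroup_power :: "nat set \<Rightarrow> nat \<Rightarrow> nat set" where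
  "semigroup_power A 0 = generated_semigroup A"
| "semigroup_power A (Suc k) = {u + a | u a. u \<in> semigroup_power A k \<and> a \<in> A}"

text \<open>The largest number of generators that add up to \<open>s\<close>; this is the \<open>\<mm>\<close>-adic order of \<open>t\<^sup>s\<close>.\<close>

definition semigroup_ord :: "nat set \<Rightarrow> nat \<Rightarrow> nat" where
  "semigroup_ord A s = Max {k. s \<in> semigroup_power A k}"

lemma fps_mult_nonzeroD:
  fixes F H :: "'k::field fps"
  assumes "fps_nth (F * H) s \<noteq> 0"
  obtains u where "u \<le> s" "fps_nth F u \<noteq> 0" "fps_nth H (s - u) \<noteq> 0"
proof -
  from assms have "\<exists>i\<in>{0..s}. fps_nth F i * fps_nth H (s - i) \<noteq> 0"
    unfolding fps_mult_nth by (metis (mono_tags, lifting) sum.neutral)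
  then show ?thesis using that by auto
qed

locale positive_generators =
  fixes A :: "nat set"
  assumes fin: "finite A" and pos: "0 \<notin> A" and ne: "A \<noteq> {}"
begin

abbreviation S :: "nat set" where "S \<equiv> generated_semigroup A"
abbreviation m :: nat where "m \<equiv> Min A"

lemma m_pos: "m > 0"
  using fin ne pos Min_in[OF fin ne] by (metis gr0I)

lemma m_in: "m \<in> A"
  using fin ne by simp

lemma A_subset: "A \<subseteq> S"
  using generated_semigroup_incl[OF fin] by blast

lemma power_SucI: "u \<in> semigroup_power A k \<Longrightarrow> a \<in> A \<Longrightarrow> u + a \<in> semigroup_power A (Suc k)"
  by auto

lemma power_Suc_subset: "semigroup_power A (Suc k) \<subseteq> semigroup_power A k"
proof (induction k)
  case 0
  show ?case using A_subset by (auto intro: generated_semigroup_add)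
next
  case (Suc k)
  show ?case
  proof
    fix s assume "s \<in> semigroup_power A (Suc (Suc k))"
    then obtain u a where u: "s = u + a" "u \<in> semigroup_power A (Suc k)" "a \<in> A"
      by (auto simp only: semigroup_power.simps(2)[of A "Suc k"])
    then show "s \<in> semigroup_power A (Suc k)" using Suc power_SucI by blast
  qed
qed

lemma power_antimono: "i \<le> j \<Longrightarrow> semigroup_power A j \<subseteq> semigroup_power A i"
  by (rule lift_Suc_antimono_le[of "semigroup_power A"]) (rule power_Suc_subset)

lemma power_subset: "semigroup_power A k \<subseteq> S"
  using power_antimono[of 0 k] by simp

lemma power_add_0: "u \<in> semigroup_power A i \<Longrightarrow> v \<in> S \<Longrightarrow> u + v \<in> semigroup_power A i"
proof (induction i arbitrary: u)
  case 0
  then show ?case by (simp add: generated_semigroup_add)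
next
  case (Suc i)
  then obtain w a where w: "u = w + a" "w \<in> semigroup_power A i" "a \<in> A" by auto
  then have "w + v \<in> semigroup_power A i" using Suc by blast
  moreover have "u + v = (w + v) + a" using w by simp
  ultimately show ?case using w(3) power_SucI by (metis add_Suc_right)
qed

lemma power_add:
  assumes "u \<in> semigroup_power A i" "v \<in> semigroup_power A j"
  shows "u + v \<in> semigroup_power A (i + j)"
  using assms(2)
proof (induction j arbitrary: v)
  case 0
  then show ?case using power_add_0 assms(1) by simp
next
  case (Suc j)
  then obtain w a where w: "v = w + a" "w \<in> semigroup_power A j" "a \<in> A" by auto
  then have "u + w \<in> semigroup_power A (i + j)" using Suc by blast
  moreover have "u + v = (u + w) + a" using w by simp
  ultimately show ?case using w(3) power_SucI by (metis add_Suc_right)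
qed

lemma nonzero_power_1:
  assumes "s \<in> S" "s \<noteq> 0"
  shows "s \<in> semigroup_power A 1"
proof -
  have "S \<subseteq> {s. s = 0 \<or> s \<in> semigroup_power A 1}"
  proof (rule generated_semigroup_least[OF fin])
    show "A \<subseteq> {s. s = 0 \<or> s \<in> semigroup_power A 1}"
      using generated_semigroup_zero[of A] by force
    show "u + v \<in> {s. s = 0 \<or> s \<in> semigroup_power A 1}"
      if "u \<in> {s. s = 0 \<or> s \<in> semigroup_power A 1}" "v \<in> {s. s = 0 \<or> s \<in> semigroup_power A 1}" for u v
      using that power_add[of u 1 v 1] power_antimono[of 1 2] by (auto simp del: semigroup_power.simps simp: numeral_2_eq_2)
  qed simp
  then show ?thesis using assms by auto
qed

lemma power_lower: "s \<in> semigroup_power A k \<Longrightarrow> k * m \<le> s"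
proof (induction k arbitrary: s)
  case (Suc k)
  then obtain u a where u: "s = u + a" "u \<in> semigroup_power A k" "a \<in> A" by auto
  then have "k * m \<le> u" "m \<le> a" using Suc fin by auto
  then show ?case using u(1) by simp
qed simp

text \<open>Writing \<open>s\<close> as a sum of generators in any way gives such a \<open>k\<close>.  The bound makes the set of all \<open>s\<close> of
a given order finite, so that elements of the tangent cone have finitely many coefficients.\<close>

lemma power_upper: "s \<in> S \<Longrightarrow> \<exists>k. s \<in> semigroup_power A k \<and> s \<le> k * Max A"
proof (induction s rule: less_induct)
  case (less s)
  show ?case
  proof (cases "s = 0")
    case True
    then show ?thesis using less.prems by (intro exI[of _ 0]) simp
  next
    case False
    then obtain u a where u: "s = u + a" "u \<in> S" "a \<in> A"
      using nonzero_power_1[OF less.prems] by auto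
    then have "a \<noteq> 0" using pos by metis
    then obtain k where k: "u \<in> semigroup_power A k" "u \<le> k * Max A" using less.IH[of u] u by auto
    moreover have "a \<le> Max A" using u(3) fin by simp
    ultimately show ?thesis using u by (intro exI[of _ "Suc k"]) auto
  qed
qed

lemma finite_orders: "finite {k. s \<in> semigroup_power A k}"
proof (rule finite_subset)
  show "{k. s \<in> semigroup_power A k} \<subseteq> {..s}"
  proof
    fix k assume "k \<in> {k. s \<in> semigroup_power A k}"
    then have "k * m \<le> s" using power_lower by blast
    moreover have "k * 1 \<le> k * m" using m_pos by (intro mult_left_mono) simp_all
    ultimately show "k \<in> {..s}" unfolding atMost_iff by linarith
  qed
qed simp

lemma power_iff_ord:
  assumes "s \<in> S"
  shows "s \<in> semigroup_power A k \<longleftrightarrow> k \<le> semigroup_ord A s"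
proof
  assume "s \<in> semigroup_power A k"
  then show "k \<le> semigroup_ord A s" unfolding semigroup_ord_def using finite_orders by simp
next
  assume k: "k \<le> semigroup_ord A s"
  have "{k. s \<in> semigroup_power A k} \<noteq> {}" using assms semigroup_power.simps(1) by blast
  from Max_in[OF finite_orders this] have "s \<in> semigroup_power A (semigroup_ord A s)"
    by (simp add: semigroup_ord_def)
  then show "s \<in> semigroup_power A k" using power_antimono[OF k] by blast
qed

lemma power_iff: "s \<in> semigroup_power A k \<longleftrightarrow> s \<in> S \<and> k \<le> semigroup_ord A s"
  using power_iff_ord power_subset by blast

lemma ord_add: "u \<in> S \<Longrightarrow> v \<in> S \<Longrightarrow> semigroup_ord A u + semigroup_ord A v \<le> semigroup_ord A (u + v)"
  using power_add[of u "semigroup_ord A u" v "semigroup_ord A v"] by (simp add: power_iff)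

lemma ord_lower: "s \<in> S \<Longrightarrow> semigroup_ord A s * m \<le> s"
  using power_lower by (simp add: power_iff)

lemma ord_upper: "s \<in> S \<Longrightarrow> s \<le> semigroup_ord A s * Max A"
proof -
  assume s: "s \<in> S"
  then obtain k where "s \<in> semigroup_power A k" "s \<le> k * Max A" using power_upper by blast
  moreover from this have "k * Max A \<le> semigroup_ord A s * Max A"
    by (intro mult_right_mono) (simp_all add: power_iff)
  ultimately show ?thesis by linarith
qed

lemma multiple_in: "k * m \<in> S"
  by (induction k) (use m_in A_subset generated_semigroup_zero generated_semigroup_add in auto)

lemma ord_multiple: "semigroup_ord A (k * m) = k"
proof (rule antisym)
  show "semigroup_ord A (k * m) \<le> k" using ord_lower[OF multiple_in, of k] m_pos by simp
  have "k * m \<in> semigroup_power A k"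
  proof (induction k)
    case (Suc k)
    then have "k * m + m \<in> semigroup_power A (Suc k)" using m_in by auto
    then show ?case by (simp add: add.commute)
  qed (simp add: generated_semigroup_zero)
  then show "k \<le> semigroup_ord A (k * m)" by (simp add: power_iff)
qed

lemma ord_0: "semigroup_ord A 0 = 0"
  using ord_multiple[of 0] by simp


section \<open>Powers of the maximal ideal\<close>

text \<open>An ideal power has to keep the form in which \<open>in_P\<close>, the description of its elements by their
  exponents, applies to it.\<close>

declare nat_pow_Suc [simp del]

abbreviation R :: "'k::field fps ring" where "R \<equiv> semigroup_ring S"
abbreviation I :: "'k::field fps set" where "I \<equiv> semigroup_max_ideal S"
abbreviation P :: "nat \<Rightarrow> 'k::field fps set" where "P k \<equiv> ideal_power R I k"

lemma in_R: "F \<in> carrier R \<longleftrightarrow> (\<forall>s. fps_nth F s \<noteq> 0 \<longrightarrow> s \<in> S)"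
  using carrier_semigroup_ring[OF fin] by blast

lemma cring_R: "cring (R :: 'k::field fps ring)"
  by (rule cring_semigroup_ring[OF fin])

lemma ideal_I: "ideal (I :: 'k::field fps set) R"
proof -
  interpret R: cring "R :: 'k fps ring" by (rule cring_R)
  have "minimal_generators S \<subseteq> S" by (auto simp: minimal_generators_def)
  then show ?thesis unfolding semigroup_max_ideal_def
    by (intro R.genideal_ideal) (auto simp: in_R fps_X_power_nth split: if_splits)
qed

lemma ideal_P: "ideal (P k :: 'k::field fps set) R"
  by (rule cring.ideal_ideal_power[OF cring_R ideal_I])

lemma P_Suc: "P (Suc k) = ideal_prod R (P k) I"
  by (simp add: ideals_set_def nat_pow_Suc)

lemma P_0: "P 0 = carrier R"
  by (simp add: ideals_set_def)

text \<open>The ideal \<open>\<mm>\<^sup>k\<close> is spanned, in the sense of power series, by the monomials it contains.  For the harder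
inclusion every exponent \<open>s\<close> of \<open>F\<close> is assigned a generator \<open>g s\<close> that can be split off from it;
collecting the terms with \<open>g s = a\<close> writes \<open>F\<close> as a finite sum of products \<open>H a * t\<^sup>a\<close> with \<open>H a\<close> in the
preceding power.\<close>

lemma in_P: "F \<in> P k \<longleftrightarrow> (\<forall>s. fps_nth F s \<noteq> 0 \<longrightarrow> s \<in> semigroup_power A k)"
  for F :: "'k::field fps"
proof (induction k arbitrary: F)
  case 0
  show ?case unfolding P_0 by (simp add: in_R)
next
  case (Suc k)
  have I: "H \<in> I \<longleftrightarrow> (\<forall>s. fps_nth H s \<noteq> 0 \<longrightarrow> s \<in> semigroup_power A 1)" for H :: "'k fps"
  proof -
    have "H \<in> I \<longleftrightarrow> (\<forall>s. fps_nth H s \<noteq> 0 \<longrightarrow> s \<in> S) \<and> fps_nth H 0 = 0"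
      unfolding semigroup_max_ideal_eq[OF fin] by (simp add: in_R)
    also have "\<dots> \<longleftrightarrow> (\<forall>s. fps_nth H s \<noteq> 0 \<longrightarrow> s \<in> semigroup_power A 1)"
      using nonzero_power_1 power_subset[of 1] power_lower[of 0 1] m_pos
      by (metis less_numeral_extra(3) le_zero_eq mult_1 subsetD)
    finally show ?thesis .
  qed
  show ?case
  proof
    assume "F \<in> P (Suc k)"
    then have "F \<in> ideal_prod R (P k) I" unfolding P_Suc .
    then show "\<forall>s. fps_nth F s \<noteq> 0 \<longrightarrow> s \<in> semigroup_power A (Suc k)"
    proof (induction rule: ideal_prod.induct)
      case (prod F H)
      show ?case
      proof (intro allI impI)
        fix s assume "fps_nth (F \<otimes>\<^bsub>R\<^esub> H) s \<noteq> 0"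
        then obtain u where u: "u \<le> s" "fps_nth F u \<noteq> 0" "fps_nth H (s - u) \<noteq> 0"
          by (auto simp: semigroup_ring_simps elim: fps_mult_nonzeroD)
        then have "u + (s - u) \<in> semigroup_power A (k + 1)"
          using prod Suc.IH I power_add by blast
        then show "s \<in> semigroup_power A (Suc k)" using u(1) by simp
      qed
    next
      case (sum F H)
      have "fps_nth F s \<noteq> 0 \<or> fps_nth H s \<noteq> 0" if "fps_nth (F + H) s \<noteq> 0" for s
        using that by auto
      then show ?case using sum by (metis semigroup_ring_simps(2))
    qed
  next
    assume F: "\<forall>s. fps_nth F s \<noteq> 0 \<longrightarrow> s \<in> semigroup_power A (Suc k)"
    have "\<exists>a. a \<in> A \<and> a \<le> s \<and> s - a \<in> semigroup_power A k" if s: "s \<in> semigroup_power A (Suc k)" for s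
    proof -
      from s obtain u a where "s = u + a" "u \<in> semigroup_power A k" "a \<in> A" by auto
      then show ?thesis by (intro exI[of _ a]) simp
    qed
    then obtain g where g: "\<And>s. s \<in> semigroup_power A (Suc k) \<Longrightarrow> g s \<in> A \<and> g s \<le> s \<and> s - g s \<in> semigroup_power A k"
      by metis
    define H where "H a = Abs_fps (\<lambda>u. if g (u + a) = a then fps_nth F (u + a) else 0)" for a
    have H: "H a \<in> P k" if "a \<in> A" for a
      unfolding Suc.IH using g F by (auto simp: H_def) (metis diff_add_inverse2)
    have X: "(fps_X ^ a :: 'k fps) \<in> I" if "a \<in> A" for a
      unfolding I using nonzero_power_1[of a] A_subset pos that
      by (auto simp: fps_X_power_nth simp del: semigroup_power.simps)
    have eq: "F = (\<Sum>a\<in>A. H a * fps_X ^ a)"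
    proof (rule fps_ext)
      fix s
      have "fps_nth (\<Sum>a\<in>A. H a * fps_X ^ a) s = (\<Sum>a\<in>A. if s < a then 0 else fps_nth (H a) (s - a))"
        by (simp add: fps_sum_nth fps_X_power_mult_right_nth)
      also have "\<dots> = (\<Sum>a\<in>A. if a = g s then fps_nth F s else 0)"
      proof (rule sum.cong)
        fix a assume "a \<in> A"
        show "(if s < a then 0 else fps_nth (H a) (s - a)) = (if a = g s then fps_nth F s else 0)"
          using g[of s] F by (auto simp: H_def simp del: semigroup_power.simps)
      qed simp
      also have "\<dots> = fps_nth F s" using g[of s] F fin by auto
      finally show "fps_nth F s = fps_nth (\<Sum>a\<in>A. H a * fps_X ^ a) s" by simp
    qed
    interpret Q: ideal "P (Suc k) :: 'k fps set" R by (rule ideal_P)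
    have "(\<Sum>a\<in>B. H a * fps_X ^ a) \<in> P (Suc k)" if "finite B" "B \<subseteq> A" for B
      using that
    proof (induction B rule: finite_induct)
      case empty
      show ?case using additive_subgroup.zero_closed[OF Q.is_additive_subgroup] by (simp add: semigroup_ring_simps)
    next
      case (insert a B)
      then have "H a \<otimes>\<^bsub>R\<^esub> fps_X ^ a \<in> P (Suc k)"
        unfolding P_Suc by (intro ideal_prod.prod H X) auto
      then show ?case using insert additive_subgroup.a_closed[OF Q.is_additive_subgroup] by (simp add: semigroup_ring_simps)
    qed
    then show "F \<in> P (Suc k)" using eq fin by auto
  qed
qed


section \<open>Coefficients of an element of the tangent cone\<close>

abbreviation G :: "(nat \<Rightarrow> 'k::field fps set) ring" where "G \<equiv> tangent_cone S"

text \<open>The monomials \<open>t\<^sup>s\<close> with \<open>s\<close> of order \<open>n\<close> form a basis of \<open>\<mm>\<^sup>n/\<mm>\<^sup>n\<^sup>+\<^sup>1\<close>, so the tangent cone has a basis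
indexed by the semigroup.  The coefficient at \<open>s\<close> is read off from any representative of the component
whose degree is the order of \<open>s\<close>.\<close>

definition graded_coeff :: "(nat \<Rightarrow> 'k::field fps set) \<Rightarrow> nat \<Rightarrow> 'k" where
  "graded_coeff x s = fps_nth (SOME a. a \<in> x (semigroup_ord A s)) s"

lemma cring_G: "cring (G :: (nat \<Rightarrow> 'k::field fps set) ring)"
  unfolding tangent_cone_def by (rule cring.cring_assoc_graded[OF cring_R ideal_I])

lemma in_coset: "b \<in> P n +>\<^bsub>R\<^esub> a \<longleftrightarrow> b - a \<in> P n" for a b :: "'k::field fps"
proof -
  have "b \<in> P n +>\<^bsub>R\<^esub> a \<longleftrightarrow> (\<exists>h\<in>P n. b = h + a)"
    by (simp add: a_r_coset_def' semigroup_ring_simps)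
  also have "\<dots> \<longleftrightarrow> b - a \<in> P n" by (metis add_diff_cancel_right' diff_add_cancel)
  finally show ?thesis .
qed

lemma zero_in_P: "0 \<in> P n"
  unfolding in_P by simp

lemma coset_zero: "P n +>\<^bsub>R\<^esub> 0 = P n"
  using in_coset[of _ n 0] by auto

lemma in_G: "x \<in> carrier G \<longleftrightarrow>
    (\<forall>n. \<exists>a\<in>P n. x n = P (Suc n) +>\<^bsub>R\<^esub> a) \<and> finite {n. x n \<noteq> P (Suc n)}"
  unfolding tangent_cone_def assoc_graded_def by simp

lemma representatives:
  assumes "x \<in> carrier G"
  obtains a where "\<And>n. a n \<in> P n" "\<And>n. x n = P (Suc n) +>\<^bsub>R\<^esub> a n"
  using assms unfolding in_G by metis

lemma graded_coeff_local:
  fixes x :: "nat \<Rightarrow> 'k::field fps set"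
  assumes x: "x n = P (Suc n) +>\<^bsub>R\<^esub> a" and n: "semigroup_ord A s = n"
  shows "graded_coeff x s = fps_nth a s"
proof -
  note x = x[folded n]
  define b where "b = (SOME b. b \<in> x (semigroup_ord A s))"
  have "a \<in> x (semigroup_ord A s)" unfolding x in_coset using zero_in_P by simp
  then have "b \<in> x (semigroup_ord A s)" unfolding b_def by (rule someI)
  then have "b - a \<in> P (Suc (semigroup_ord A s))" unfolding x in_coset .
  moreover have "s \<notin> semigroup_power A (Suc (semigroup_ord A s))" unfolding power_iff by simp
  ultimately have "fps_nth (b - a) s = 0" unfolding in_P by blast
  then show ?thesis by (simp add: graded_coeff_def b_def)
qed

lemma graded_coeff_eq:
  fixes x :: "nat \<Rightarrow> 'k::field fps set"
  assumes "\<And>n. x n = P (Suc n) +>\<^bsub>R\<^esub> a n"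
  shows "graded_coeff x s = fps_nth (a (semigroup_ord A s)) s"
  by (rule graded_coeff_local[of x, OF assms refl])

lemma graded_coeff_support:
  assumes "x \<in> carrier G" "graded_coeff x s \<noteq> 0"
  shows "s \<in> S"
proof -
  obtain a where a: "\<And>n. a n \<in> P n" "\<And>n. x n = P (Suc n) +>\<^bsub>R\<^esub> a n"
    using representatives[OF assms(1)] by blast
  then show ?thesis using assms(2) graded_coeff_eq[OF a(2)] in_P power_iff by metis
qed

lemma finite_support:
  assumes "x \<in> carrier G"
  shows "finite {s. graded_coeff x s \<noteq> 0}"
proof (rule finite_subset)
  let ?N = "{n. x n \<noteq> P (Suc n)}"
  show "{s. graded_coeff x s \<noteq> 0} \<subseteq> (\<Union>n\<in>?N. {..n * Max A})"
  proof
    fix s assume "s \<in> {s. graded_coeff x s \<noteq> 0}"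
    then have s: "graded_coeff x s \<noteq> 0" by simp
    then have "semigroup_ord A s \<in> ?N" using graded_coeff_local[of x "semigroup_ord A s" 0 s] coset_zero by auto
    moreover have "s \<le> semigroup_ord A s * Max A" using ord_upper graded_coeff_support[OF assms s] by blast
    ultimately show "s \<in> (\<Union>n\<in>?N. {..n * Max A})" by blast
  qed
  show "finite (\<Union>n\<in>?N. {..n * Max A})" using assms by (simp add: in_G)
qed

lemma zero_G: "\<zero>\<^bsub>G\<^esub> = (\<lambda>n. P (Suc n))"
  by (simp add: tangent_cone_def assoc_graded_def)

lemma graded_coeff_zero: "graded_coeff \<zero>\<^bsub>G\<^esub> s = 0"
  using graded_coeff_local[of "\<zero>\<^bsub>G\<^esub>" "semigroup_ord A s" 0 s] by (simp add: zero_G coset_zero)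

lemma graded_coeff_eq_0:
  fixes x :: "nat \<Rightarrow> 'k::field fps set"
  assumes x: "x \<in> carrier G" and 0: "\<And>s. graded_coeff x s = 0"
  shows "x = \<zero>\<^bsub>G\<^esub>"
proof
  fix n
  obtain a where a: "\<And>n. a n \<in> P n" "\<And>n. x n = P (Suc n) +>\<^bsub>R\<^esub> a n"
    using representatives[OF x] by blast
  have "a n \<in> P (Suc n)"
    unfolding in_P
  proof (intro allI impI)
    fix s assume s: "fps_nth (a n) s \<noteq> 0"
    then have "s \<in> semigroup_power A n" using a(1)[of n] unfolding in_P by blast
    moreover have "semigroup_ord A s \<noteq> n" using s graded_coeff_eq[OF a(2), of s] 0 by auto
    ultimately show "s \<in> semigroup_power A (Suc n)" unfolding power_iff by simp
  qed
  interpret Q: ideal "P (Suc n) :: 'k fps set" R by (rule ideal_P)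
  have "x n = P (Suc n)"
    unfolding a(2) using \<open>a n \<in> P (Suc n)\<close> by (rule Q.a_rcos_const)
  then show "x n = \<zero>\<^bsub>G\<^esub> n" by (simp add: zero_G)
qed

lemma graded_coeff_one: "graded_coeff \<one>\<^bsub>G\<^esub> s = (if s = 0 then 1 else 0)"
proof -
  have "\<one>\<^bsub>G\<^esub> n = P (Suc n) +>\<^bsub>R\<^esub> (if n = 0 then 1 else 0)" for n
    by (simp add: tangent_cone_def assoc_graded_def coset_zero semigroup_ring_simps)
  from graded_coeff_eq[of "\<one>\<^bsub>G\<^esub>", OF this, of s] show ?thesis using ord_0 by auto
qed

lemma graded_coeff_add:
  fixes x y :: "nat \<Rightarrow> 'k::field fps set"
  assumes "x \<in> carrier G" "y \<in> carrier G"
  shows "graded_coeff (x \<oplus>\<^bsub>G\<^esub> y) s = graded_coeff x s + graded_coeff y s"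
proof -
  obtain a where a: "\<And>n. a n \<in> P n" "\<And>n. x n = P (Suc n) +>\<^bsub>R\<^esub> a n"
    using representatives[OF assms(1)] by blast
  obtain b where b: "\<And>n. b n \<in> P n" "\<And>n. y n = P (Suc n) +>\<^bsub>R\<^esub> b n"
    using representatives[OF assms(2)] by blast
  have "(x \<oplus>\<^bsub>G\<^esub> y) n = P (Suc n) +>\<^bsub>R\<^esub> (a n + b n)" for n
  proof -
    interpret Q: ideal "P (Suc n) :: 'k fps set" R by (rule ideal_P)
    have "a n \<in> carrier R" "b n \<in> carrier R" using a(1) b(1) ideal.Icarr[OF ideal_P] by blast+
    then show ?thesis using Q.a_rcos_sum[of "a n" "b n"]
      by (simp add: tangent_cone_def assoc_graded_def a(2)[unfolded semigroup_ring_simps] b(2) semigroup_ring_simps)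
  qed
  then show ?thesis using graded_coeff_eq[of "x \<oplus>\<^bsub>G\<^esub> y" "\<lambda>n. a n + b n"] graded_coeff_eq[OF a(2)] graded_coeff_eq[OF b(2)] by simp
qed

lemma mult_representative:
  fixes a b :: "nat \<Rightarrow> 'k::field fps"
  assumes a: "\<And>n. a n \<in> P n" "\<And>n. x n = P (Suc n) +>\<^bsub>R\<^esub> a n"
    and b: "\<And>n. b n \<in> P n" "\<And>n. y n = P (Suc n) +>\<^bsub>R\<^esub> b n"
  shows "(x \<otimes>\<^bsub>G\<^esub> y) n = P (Suc n) +>\<^bsub>R\<^esub> (\<Sum>i\<le>n. a i * b (n - i))"
proof -
  interpret R: cring "R :: 'k fps ring" by (rule cring_R)
  interpret Q: ideal "P (Suc n) :: 'k fps set" R by (rule ideal_P)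
  interpret H: ring_hom_cring R "R Quot P (Suc n)" "(+>\<^bsub>R\<^esub>) (P (Suc n) :: 'k fps set)"
    by (rule Q.rcos_ring_hom_cring) (rule cring_R)
  have carr: "a i \<in> carrier R" "b i \<in> carrier R" for i
    using a(1) b(1) ideal.Icarr[OF ideal_P] by blast+
  have fc: "(\<lambda>i. a i * b (n - i)) \<in> B \<rightarrow> carrier R" for B
    using R.m_closed[OF carr(1) carr(2)] by (simp add: semigroup_ring_simps)
  have sum: "(\<Oplus>\<^bsub>R\<^esub>i\<in>B. a i * b (n - i)) = (\<Sum>i\<in>B. a i * b (n - i))" if "finite B" for B
    using that
  proof (induction B rule: finite_induct)
    case empty
    show ?case by (simp add: semigroup_ring_simps)
  next
    case (insert i B)
    then show ?case using fc[of "insert i B"] by (simp add: semigroup_ring_simps)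
  qed
  have eq: "rcoset_mult R (P (Suc n)) (x i) (y (n - i)) = P (Suc n) +>\<^bsub>R\<^esub> (a i * b (n - i))"
    if "i \<in> {..n}" for i
    using that R.graded_mult_cosets[OF ideal_I a(1) b(1), of i "n - i"]
    unfolding a(2) b(2) semigroup_ring_simps by simp
  have "(x \<otimes>\<^bsub>G\<^esub> y) n = (\<Oplus>\<^bsub>R Quot P (Suc n)\<^esub>i\<in>{..n}. rcoset_mult R (P (Suc n)) (x i) (y (n - i)))"
    by (simp add: tangent_cone_def assoc_graded_def)
  also have "\<dots> = (\<Oplus>\<^bsub>R Quot P (Suc n)\<^esub>i\<in>{..n}. ((+>\<^bsub>R\<^esub>) (P (Suc n)) \<circ> (\<lambda>i. a i * b (n - i))) i)"
  proof (rule H.S.finsum_cong')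
    show "((+>\<^bsub>R\<^esub>) (P (Suc n)) \<circ> (\<lambda>i. a i * b (n - i))) \<in> {..n} \<rightarrow> carrier (R Quot P (Suc n))"
      by (rule Pi_I, unfold o_apply, rule H.hom_closed, rule Pi_mem[OF fc])
    show "rcoset_mult R (P (Suc n)) (x i) (y (n - i)) = ((+>\<^bsub>R\<^esub>) (P (Suc n)) \<circ> (\<lambda>i. a i * b (n - i))) i"
      if "i \<in> {..n}" for i
      unfolding eq[OF that] by simp
  qed simp
  also have "\<dots> = P (Suc n) +>\<^bsub>R\<^esub> (\<Oplus>\<^bsub>R\<^esub>i\<in>{..n}. a i * b (n - i))"
    by (rule H.hom_finsum[OF fc, symmetric])
  finally show ?thesis using sum by simp
qed

text \<open>The basis elements at \<open>u\<close> and \<open>v\<close> multiply to the one at \<open>u + v\<close> if orders add up, and to zero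
otherwise, because then \<open>t\<^sup>u\<^sup>+\<^sup>v\<close> lies in a higher power of \<open>\<mm>\<close>.\<close>

lemma graded_coeff_mult:
  assumes x: "x \<in> carrier G" and y: "y \<in> carrier G"
  shows "graded_coeff (x \<otimes>\<^bsub>G\<^esub> y) s =
    (\<Sum>u\<le>s. if semigroup_ord A u + semigroup_ord A (s - u) = semigroup_ord A s
            then graded_coeff x u * graded_coeff y (s - u) else 0)"
proof -
  obtain a where a: "\<And>n. a n \<in> P n" "\<And>n. x n = P (Suc n) +>\<^bsub>R\<^esub> a n"
    using representatives[OF x] by blast
  obtain b where b: "\<And>n. b n \<in> P n" "\<And>n. y n = P (Suc n) +>\<^bsub>R\<^esub> b n"
    using representatives[OF y] by blast
  let ?n = "semigroup_ord A s"
  have "graded_coeff (x \<otimes>\<^bsub>G\<^esub> y) s = fps_nth (\<Sum>i\<le>?n. a i * b (?n - i)) s"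
    by (rule graded_coeff_eq[OF mult_representative[OF a b]])
  also have "\<dots> = (\<Sum>i\<le>?n. \<Sum>u\<le>s. fps_nth (a i) u * fps_nth (b (?n - i)) (s - u))"
    by (simp add: fps_sum_nth fps_mult_nth atLeast0AtMost)
  also have "\<dots> = (\<Sum>u\<le>s. \<Sum>i\<le>?n. fps_nth (a i) u * fps_nth (b (?n - i)) (s - u))"
    by (rule sum.swap)
  also have "\<dots> = (\<Sum>u\<le>s. if semigroup_ord A u + semigroup_ord A (s - u) = ?n
            then graded_coeff x u * graded_coeff y (s - u) else 0)"
  proof (rule sum.cong)
    fix u assume "u \<in> {..s}"
    then have u: "u \<le> s" by simp
    let ?f = "\<lambda>i. fps_nth (a i) u * fps_nth (b (?n - i)) (s - u)"
    have nz: "i = semigroup_ord A u \<and> ?n - i = semigroup_ord A (s - u)" if "i \<le> ?n" "?f i \<noteq> 0" for i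
    proof -
      have "u \<in> semigroup_power A i" "s - u \<in> semigroup_power A (?n - i)"
        using that a(1)[of i] b(1)[of "?n - i"] unfolding in_P by auto
      then have "u \<in> S" "s - u \<in> S" "i \<le> semigroup_ord A u" "?n - i \<le> semigroup_ord A (s - u)"
        unfolding power_iff by auto
      moreover from this have "semigroup_ord A u + semigroup_ord A (s - u) \<le> ?n"
        using ord_add[of u "s - u"] u by simp
      ultimately show ?thesis using that(1) by linarith
    qed
    show "(\<Sum>i\<le>?n. ?f i) = (if semigroup_ord A u + semigroup_ord A (s - u) = ?n
            then graded_coeff x u * graded_coeff y (s - u) else 0)"
    proof (cases "semigroup_ord A u + semigroup_ord A (s - u) = ?n")
      case True
      have "(\<Sum>i\<le>?n. ?f i) = (\<Sum>i\<in>{semigroup_ord A u}. ?f i)"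
        by (rule sum.mono_neutral_right) (use nz True in auto)
      also have "\<dots> = ?f (semigroup_ord A u)" by simp
      also have "?n - semigroup_ord A u = semigroup_ord A (s - u)" using True by simp
      also have "fps_nth (a (semigroup_ord A u)) u * fps_nth (b (semigroup_ord A (s - u))) (s - u)
          = graded_coeff x u * graded_coeff y (s - u)"
        by (simp only: graded_coeff_eq[OF a(2), of u] graded_coeff_eq[OF b(2), of "s - u"])
      finally show ?thesis using True by simp
    next
      case False
      have "?f i = 0" if "i \<le> ?n" for i using nz[OF that] that False by fastforce
      then have "(\<Sum>i\<le>?n. ?f i) = 0" by (intro sum.neutral) simp
      then show ?thesis using False by simp
    qed
  qed simp
  finally show ?thesis .
qed

end


section \<open>The tangent cone when adding the multiplicity raises the order by one\<close>

text \<open>With \<open>m\<close> the smallest generator, the additional assumption says that the initial form of \<open>t\<^sup>m\<close> maps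
the basis injectively to itself, i.e. is a nonzerodivisor on the tangent cone.\<close>

locale order_additive_generators = positive_generators +
  assumes ord_step: "s \<in> generated_semigroup A \<Longrightarrow> semigroup_ord A (s + Min A) = semigroup_ord A s + 1"
begin

lemma add_multiple_in: "s \<in> S \<Longrightarrow> s + k * m \<in> S"
  by (intro generated_semigroup_add multiple_in)

lemma ord_steps: "s \<in> S \<Longrightarrow> semigroup_ord A (s + k * m) = semigroup_ord A s + k"
proof (induction k)
  case (Suc k)
  then show ?case using ord_step[OF add_multiple_in, of s k] by (simp add: ac_simps)
qed simp

text \<open>By how much \<open>s\<close> exceeds the smallest sum of as many generators.  It is additive wherever the product of
basis elements is nonzero, and thus a second grading of the tangent cone.\<close>

definition defect :: "nat \<Rightarrow> nat" where
  "defect s = s - semigroup_ord A s * m"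

lemma defect_eq: "s \<in> S \<Longrightarrow> s = semigroup_ord A s * m + defect s"
  using ord_lower[of s] by (simp add: defect_def)

lemma defect_add_multiple: "s \<in> S \<Longrightarrow> defect (s + k * m) = defect s"
  by (simp add: defect_def ord_steps add_mult_distrib)

lemma defect_add:
  assumes "u \<in> S" "v \<in> S" "semigroup_ord A u + semigroup_ord A v = semigroup_ord A (u + v)"
  shows "defect (u + v) = defect u + defect v"
  using defect_eq[OF assms(1)] defect_eq[OF assms(2)]
  by (simp add: defect_def assms(3)[symmetric] add_mult_distrib)

text \<open>Adding \<open>m\<close> does not change the defect, so only the least element of each residue class modulo \<open>m\<close>
matters.\<close>

lemma defect_bounded: "\<exists>D. \<forall>s\<in>S. defect s \<le> D"
proof -
  define w where "w r = (LEAST s. s \<in> S \<and> s mod m = r)" for r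
  have "defect s \<le> Max ((defect \<circ> w) ` {..<m})" if s: "s \<in> S" for s
  proof -
    let ?w = "w (s mod m)"
    have w: "?w \<in> S" "?w mod m = s mod m" and le: "?w \<le> s"
      unfolding w_def using LeastI[of "\<lambda>t. t \<in> S \<and> t mod m = s mod m" s]
        Least_le[of "\<lambda>t. t \<in> S \<and> t mod m = s mod m" s] s by auto
    obtain k where "s = ?w + k * m" using w(2) le
      by (metis le_add_diff_inverse mod_eq_dvd_iff_nat dvd_div_mult_self)
    then have "defect s = (defect \<circ> w) (s mod m)" by (metis defect_add_multiple[OF w(1)] o_apply)
    then show ?thesis using m_pos by simp
  qed
  then show ?thesis by blast
qed

lemma graded_coeff_mult_support:
  assumes "x \<in> carrier G" "y \<in> carrier G" "u \<le> s"
    "semigroup_ord A u + semigroup_ord A (s - u) = semigroup_ord A s"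
    "graded_coeff x u \<noteq> 0" "graded_coeff y (s - u) \<noteq> 0"
  shows "u \<in> S" "s - u \<in> S" "defect s = defect u + defect (s - u)"
proof -
  show u: "u \<in> S" "s - u \<in> S" using graded_coeff_support assms by blast+
  show "defect s = defect u + defect (s - u)" using defect_add[OF u] assms by simp
qed

lemma graded_coeff_mult_nonzeroE:
  assumes "x \<in> carrier G" "y \<in> carrier G" "graded_coeff (x \<otimes>\<^bsub>G\<^esub> y) s \<noteq> 0"
  obtains u where "u \<le> s" "semigroup_ord A u + semigroup_ord A (s - u) = semigroup_ord A s"
    "graded_coeff x u \<noteq> 0" "graded_coeff y (s - u) \<noteq> 0"
proof -
  from assms(3) obtain u where u: "u \<in> {..s}"
    "(if semigroup_ord A u + semigroup_ord A (s - u) = semigroup_ord A s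
      then graded_coeff x u * graded_coeff y (s - u) else 0) \<noteq> 0"
    unfolding graded_coeff_mult[OF assms(1,2)] by (rule sum.not_neutral_contains_not_neutral)
  show ?thesis by (rule that[of u]) (use u in \<open>auto split: if_splits\<close>)
qed

text \<open>The projection to the part of defect zero, which is spanned by the powers of the initial form \<open>x\<close> of
\<open>t\<^sup>m\<close> and hence a polynomial ring.\<close>

definition axis :: "(nat \<Rightarrow> 'k::field fps set) \<Rightarrow> 'k poly" where
  "axis x = Abs_poly (\<lambda>k. graded_coeff x (k * m))"

lemma coeff_axis:
  assumes "x \<in> carrier G"
  shows "Polynomial.coeff (axis x) k = graded_coeff x (k * m)"
proof -
  have "finite {k. graded_coeff x (k * m) \<noteq> 0}"
  proof (rule inj_on_finite)
    show "inj_on (\<lambda>k. k * m) {k. graded_coeff x (k * m) \<noteq> 0}" using m_pos by (auto intro: inj_onI)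
    show "(\<lambda>k. k * m) ` {k. graded_coeff x (k * m) \<noteq> 0} \<subseteq> {s. graded_coeff x s \<noteq> 0}" by auto
  qed (rule finite_support[OF assms])
  then have "\<forall>\<^sub>\<infinity>k. graded_coeff x (k * m) = 0" by (simp add: eventually_cofinite)
  then show ?thesis unfolding axis_def by (subst Abs_poly_inverse) auto
qed

lemma axis_support:
  assumes "x \<in> carrier G" "graded_coeff x s \<noteq> 0" "defect s = 0"
  shows "s = semigroup_ord A s * m" "Polynomial.coeff (axis x) (semigroup_ord A s) \<noteq> 0"
proof -
  show s: "s = semigroup_ord A s * m" using defect_eq[OF graded_coeff_support] assms by force
  then show "Polynomial.coeff (axis x) (semigroup_ord A s) \<noteq> 0" using assms by (simp add: coeff_axis)
qed

lemma axis_one: "axis \<one>\<^bsub>G\<^esub> = 1"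
proof -
  interpret G: cring G by (rule cring_G)
  show ?thesis using m_pos by (intro poly_eqI) (simp add: coeff_axis graded_coeff_one)
qed

lemma axis_add:
  assumes "x \<in> carrier G" "y \<in> carrier G"
  shows "axis (x \<oplus>\<^bsub>G\<^esub> y) = axis x + axis y"
proof -
  interpret G: cring G by (rule cring_G)
  show ?thesis using assms by (intro poly_eqI) (simp add: coeff_axis graded_coeff_add)
qed

lemma axis_mult:
  assumes x: "x \<in> carrier G" and y: "y \<in> carrier G"
  shows "axis (x \<otimes>\<^bsub>G\<^esub> y) = axis x * axis y"
proof (rule poly_eqI)
  fix k
  interpret G: cring G by (rule cring_G)
  let ?T = "\<lambda>u. if semigroup_ord A u + semigroup_ord A (k * m - u) = semigroup_ord A (k * m)
                then graded_coeff x u * graded_coeff y (k * m - u) else 0"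
  have nz: "u \<in> (\<lambda>i. i * m) ` {..k}" if u: "u \<le> k * m" "?T u \<noteq> 0" for u
  proof -
    from u(2) have *: "semigroup_ord A u + semigroup_ord A (k * m - u) = semigroup_ord A (k * m)"
      "graded_coeff x u \<noteq> 0" "graded_coeff y (k * m - u) \<noteq> 0" by (auto split: if_splits)
    note supp = graded_coeff_mult_support[OF x y u(1) *]
    have "defect (k * m) = 0" by (simp add: defect_def ord_multiple)
    then have "u = semigroup_ord A u * m" using supp(3) axis_support(1)[OF x *(2)] by simp
    moreover have "semigroup_ord A u \<le> k" using *(1) by (simp add: ord_multiple)
    ultimately show ?thesis by blast
  qed
  have "Polynomial.coeff (axis (x \<otimes>\<^bsub>G\<^esub> y)) k = (\<Sum>u\<le>k * m. ?T u)"
    using x y by (simp add: coeff_axis graded_coeff_mult)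
  also have "\<dots> = (\<Sum>u\<in>(\<lambda>i. i * m) ` {..k}. ?T u)"
  proof (rule sum.mono_neutral_right)
    show "\<forall>u\<in>{..k * m} - (\<lambda>i. i * m) ` {..k}. ?T u = 0" using nz by blast
  qed auto
  also have "\<dots> = (\<Sum>i\<le>k. ?T (i * m))"
    by (rule sum.reindex_cong[of "\<lambda>i. i * m"]) (use m_pos in \<open>simp_all add: inj_on_def\<close>)
  also have "\<dots> = (\<Sum>i\<le>k. Polynomial.coeff (axis x) i * Polynomial.coeff (axis y) (k - i))"
  proof (rule sum.cong)
    fix i assume "i \<in> {..k}"
    then have "k * m - i * m = (k - i) * m" "i + (k - i) = k" by (simp_all add: diff_mult_distrib)
    then show "?T (i * m) = Polynomial.coeff (axis x) i * Polynomial.coeff (axis y) (k - i)"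
      by (simp add: ord_multiple coeff_axis x y)
  qed simp
  also have "\<dots> = Polynomial.coeff (axis x * axis y) k" by (simp add: Polynomial.coeff_mult)
  finally show "Polynomial.coeff (axis (x \<otimes>\<^bsub>G\<^esub> y)) k = Polynomial.coeff (axis x * axis y) k" .
qed

text \<open>The value at \<open>x\<close> of a polynomial.\<close>

definition axis_elem :: "'k::field poly \<Rightarrow> nat \<Rightarrow> 'k fps set" where
  "axis_elem p n = P (Suc n) +>\<^bsub>R\<^esub> (fps_const (Polynomial.coeff p n) * fps_X ^ (n * m))"

lemma axis_elem_in: "axis_elem p \<in> carrier G"
  unfolding in_G
proof (intro conjI allI)
  fix n
  have "n * m \<in> semigroup_power A n" by (simp add: power_iff multiple_in ord_multiple)
  then have "fps_const (Polynomial.coeff p n) * fps_X ^ (n * m) \<in> P n"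
    unfolding in_P by (auto simp: fps_X_power_nth)
  then show "\<exists>a\<in>P n. axis_elem p n = P (Suc n) +>\<^bsub>R\<^esub> a"
    unfolding axis_elem_def by blast
next
  have "{n. axis_elem p n \<noteq> P (Suc n)} \<subseteq> {..Polynomial.degree p}"
  proof
    fix n assume "n \<in> {n. axis_elem p n \<noteq> P (Suc n)}"
    then have "Polynomial.coeff p n \<noteq> 0" by (auto simp: axis_elem_def coset_zero)
    then show "n \<in> {..Polynomial.degree p}" by (simp add: le_degree)
  qed
  then show "finite {n. axis_elem p n \<noteq> P (Suc n)}" by (rule finite_subset) simp
qed

lemma graded_coeff_axis_elem:
  "graded_coeff (axis_elem p) s = (if s = semigroup_ord A s * m then Polynomial.coeff p (semigroup_ord A s) else 0)"
  using graded_coeff_eq[of "axis_elem p", OF axis_elem_def] by (simp add: fps_X_power_nth)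

lemma axis_axis_elem: "axis (axis_elem p) = p"
  by (rule poly_eqI) (simp add: coeff_axis axis_elem_in graded_coeff_axis_elem ord_multiple)

lemma graded_coeff_monomial_mult:
  assumes "x \<in> carrier G"
  shows "graded_coeff (axis_elem (Polynomial.monom c k) \<otimes>\<^bsub>G\<^esub> x) s =
    (if k * m \<le> s then c * graded_coeff x (s - k * m) else 0)"
proof -
  let ?T = "\<lambda>u. if semigroup_ord A u + semigroup_ord A (s - u) = semigroup_ord A s
                then graded_coeff (axis_elem (Polynomial.monom c k)) u * graded_coeff x (s - u) else 0"
  have T: "?T u = (if u = k * m then c * graded_coeff x (s - k * m) else 0)" if "u \<le> s" for u
  proof (cases "u = k * m")
    case True
    have "semigroup_ord A s = k + semigroup_ord A (s - k * m)" if "graded_coeff x (s - k * m) \<noteq> 0"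
      using ord_steps[OF graded_coeff_support[OF assms that], of k] \<open>u \<le> s\<close> True by simp
    then show ?thesis using True by (auto simp: graded_coeff_axis_elem ord_multiple)
  next
    case False
    then have "graded_coeff (axis_elem (Polynomial.monom c k)) u = 0"
      by (auto simp: graded_coeff_axis_elem)
    then show ?thesis using False by simp
  qed
  have "graded_coeff (axis_elem (Polynomial.monom c k) \<otimes>\<^bsub>G\<^esub> x) s = (\<Sum>u\<le>s. ?T u)"
    by (rule graded_coeff_mult[OF axis_elem_in assms])
  also have "\<dots> = (\<Sum>u\<le>s. if u = k * m then c * graded_coeff x (s - k * m) else 0)"
    by (rule sum.cong) (use T in auto)
  finally show ?thesis by simp
qed

text \<open>All exponents of an element of the kernel have positive defect, so those of its \<open>k\<close>-th power have defect
at least \<open>k\<close>, but the defect is bounded.\<close>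

lemma axis_kernel_nilpotent:
  assumes x: "x \<in> carrier G" and 0: "axis x = 0"
  shows "\<exists>k::nat. x [^]\<^bsub>G\<^esub> k = \<zero>\<^bsub>G\<^esub>"
proof -
  interpret G: cring G by (rule cring_G)
  have supp: "k \<le> defect s" if "graded_coeff (x [^]\<^bsub>G\<^esub> k) s \<noteq> 0" for k :: nat and s
    using that
  proof (induction k arbitrary: s)
    case (Suc k)
    then have "graded_coeff (x [^]\<^bsub>G\<^esub> k \<otimes>\<^bsub>G\<^esub> x) s \<noteq> 0" by (simp add: nat_pow_Suc)
    then obtain u where u: "u \<le> s" "semigroup_ord A u + semigroup_ord A (s - u) = semigroup_ord A s"
      "graded_coeff (x [^]\<^bsub>G\<^esub> k) u \<noteq> 0" "graded_coeff x (s - u) \<noteq> 0"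
      by (rule graded_coeff_mult_nonzeroE[OF G.nat_pow_closed[OF x] x])
    have "k \<le> defect u" using Suc.IH u(3) .
    moreover have "defect (s - u) \<noteq> 0" using axis_support(2)[OF x u(4)] 0 by auto
    ultimately show ?case
      using graded_coeff_mult_support(3)[OF G.nat_pow_closed[OF x] x u] by simp
  qed simp
  obtain D where D: "\<And>s. s \<in> S \<Longrightarrow> defect s \<le> D" using defect_bounded by blast
  have "x [^]\<^bsub>G\<^esub> Suc D = \<zero>\<^bsub>G\<^esub>"
  proof (rule graded_coeff_eq_0)
    show c: "x [^]\<^bsub>G\<^esub> Suc D \<in> carrier G" by (rule G.nat_pow_closed[OF x])
    show "graded_coeff (x [^]\<^bsub>G\<^esub> Suc D) s = 0" for s
      using supp[of "Suc D" s] D[OF graded_coeff_support[OF c], of s] by force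
  qed
  then show ?thesis by blast
qed

text \<open>The leading coefficient of \<open>axis x\<close> and the coefficient of \<open>y\<close> at its largest exponent of least
defect multiply to a coefficient of the product: no other pair of exponents contributes, first by
defect, then by size.\<close>

lemma regular_off_axis_kernel:
  assumes x: "x \<in> carrier G" and nz: "axis x \<noteq> 0" and y: "y \<in> carrier G"
    and xy: "x \<otimes>\<^bsub>G\<^esub> y = \<zero>\<^bsub>G\<^esub>"
  shows "y = \<zero>\<^bsub>G\<^esub>"
proof (rule ccontr)
  interpret G: cring G by (rule cring_G)
  assume "y \<noteq> \<zero>\<^bsub>G\<^esub>"
  then have "\<exists>s. graded_coeff y s \<noteq> 0" using graded_coeff_eq_0[OF y] by blast
  then obtain s0 where s0: "graded_coeff y s0 \<noteq> 0"
    and min: "\<And>s. graded_coeff y s \<noteq> 0 \<Longrightarrow> defect s0 \<le> defect s"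
    using ex_has_least_nat[of "\<lambda>s. graded_coeff y s \<noteq> 0" _ defect] by blast
  define T where "T = {s. graded_coeff y s \<noteq> 0 \<and> defect s = defect s0}"
  have T: "finite T" "T \<noteq> {}"
    using finite_subset[OF _ finite_support[OF y], of T] s0 by (auto simp: T_def)
  define s where "s = Max T"
  have "s \<in> T" unfolding s_def using T by (rule Max_in)
  then have s: "graded_coeff y s \<noteq> 0" "defect s = defect s0" by (auto simp: T_def)
  have sS: "s \<in> S" using graded_coeff_support[OF y s(1)] .
  define d where "d = Polynomial.degree (axis x)"
  let ?t = "s + d * m"
  let ?T = "\<lambda>u. if semigroup_ord A u + semigroup_ord A (?t - u) = semigroup_ord A ?t
                then graded_coeff x u * graded_coeff y (?t - u) else 0"
  have only: "u = d * m" if u: "u \<le> ?t" "?T u \<noteq> 0" for u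
  proof -
    from u(2) have *: "semigroup_ord A u + semigroup_ord A (?t - u) = semigroup_ord A ?t"
      "graded_coeff x u \<noteq> 0" "graded_coeff y (?t - u) \<noteq> 0" by (auto split: if_splits)
    have "defect s0 = defect u + defect (?t - u)"
      using graded_coeff_mult_support(3)[OF x y u(1) *] defect_add_multiple[OF sS] s(2) by simp
    then have "defect u = 0" "defect (?t - u) = defect s0" using min[OF *(3)] by auto
    then have "?t - u \<in> T" and "u = semigroup_ord A u * m" and "semigroup_ord A u \<le> d"
      using *(3) axis_support[OF x *(2)] by (auto simp: T_def d_def le_degree)
    then have "?t - u \<le> s" "u \<le> d * m"
      using T(1) mult_right_mono[of "semigroup_ord A u" d m] by (auto simp: s_def)
    then show ?thesis using u(1) by linarith
  qed
  have "0 = graded_coeff (x \<otimes>\<^bsub>G\<^esub> y) ?t" by (simp add: xy graded_coeff_zero)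
  also have "\<dots> = (\<Sum>u\<le>?t. ?T u)" by (rule graded_coeff_mult[OF x y])
  also have "\<dots> = (\<Sum>u\<in>{d * m}. ?T u)"
  proof (rule sum.mono_neutral_right)
    show "\<forall>u\<in>{..?t} - {d * m}. ?T u = 0" using only by blast
  qed auto
  also have "\<dots> = Polynomial.coeff (axis x) d * graded_coeff y s"
    using ord_steps[OF sS, of d] by (simp add: ord_multiple coeff_axis[OF x])
  also have "\<dots> \<noteq> 0" using nz s(1) by (simp add: d_def)
  finally show False by simp
qed

text \<open>The leading exponents of an ideal are closed under adding \<open>m\<close>, since multiplication by
\<open>x\<close> shifts exponents by \<open>m\<close>.  One element with least leading exponent for each residue class modulo
\<open>m\<close> thus suffices to reduce every element of the ideal to zero.\<close>

lemma noetherian_G: "noetherian_ring (G :: (nat \<Rightarrow> 'k::field fps set) ring)"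
proof -
  interpret G: cring "G :: (nat \<Rightarrow> 'k fps set) ring" by (rule cring_G)
  have neg: "graded_coeff (\<ominus>\<^bsub>G\<^esub> x) s = - graded_coeff x s" if "x \<in> carrier G" for x :: "nat \<Rightarrow> 'k fps set" and s
    using graded_coeff_add[OF that G.a_inv_closed[OF that], of s] that
    by (simp add: G.r_neg graded_coeff_zero eq_neg_iff_add_eq_0 add.commute)
  show ?thesis
  proof (intro noetherian_ring.intro noetherian_ring_axioms.intro)
    show "ring (G :: (nat \<Rightarrow> 'k fps set) ring)" by (rule G.ring_axioms)
    fix J :: "(nat \<Rightarrow> 'k fps set) set"
    assume "ideal J G"
    then interpret J: ideal J G .
    define lead where "lead x = Max {s. graded_coeff x s \<noteq> 0}" for x :: "nat \<Rightarrow> 'k fps set"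
    have lead: "graded_coeff x (lead x) \<noteq> 0" "\<And>s. graded_coeff x s \<noteq> 0 \<Longrightarrow> s \<le> lead x"
      if "x \<in> J" "x \<noteq> \<zero>\<^bsub>G\<^esub>" for x
    proof -
      have "{s. graded_coeff x s \<noteq> 0} \<noteq> {}"
        using graded_coeff_eq_0[OF J.Icarr[OF that(1)]] that(2) by blast
      from Max_in[OF finite_support[OF J.Icarr[OF that(1)]] this]
      show "graded_coeff x (lead x) \<noteq> 0" by (simp add: lead_def)
      show "s \<le> lead x" if "graded_coeff x s \<noteq> 0" for s
        unfolding lead_def using finite_support[OF J.Icarr[OF \<open>x \<in> J\<close>]] that by simp
    qed
    define C where "C r = {x \<in> J. x \<noteq> \<zero>\<^bsub>G\<^esub> \<and> lead x mod m = r}" for r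
    have "\<forall>r. \<exists>g. C r \<noteq> {} \<longrightarrow> g \<in> C r \<and> (\<forall>x\<in>C r. lead g \<le> lead x)"
      using ex_has_least_nat[of "\<lambda>x. x \<in> C _" _ lead] by blast
    then obtain g where g: "\<And>r. C r \<noteq> {} \<Longrightarrow> g r \<in> C r"
      and least: "\<And>r x. x \<in> C r \<Longrightarrow> lead (g r) \<le> lead x" by (metis empty_iff)
    define B where "B = g ` {r \<in> {..<m}. C r \<noteq> {}}"
    have BJ: "B \<subseteq> J" using g by (auto simp: B_def C_def)
    then have Bc: "B \<subseteq> carrier G" using J.Icarr by blast
    interpret K: ideal "Idl\<^bsub>G\<^esub> B" G by (rule G.genideal_ideal[OF Bc])
    have "x \<in> Idl\<^bsub>G\<^esub> B" if "x \<in> J" for x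
      using that
    \<comment> \<open>The shift by one puts zero below all elements with a leading exponent.\<close>
    proof (induction "if x = \<zero>\<^bsub>G\<^esub> then 0 else Suc (lead x)" arbitrary: x rule: less_induct)
      case less
      show ?case
      proof (cases "x = \<zero>\<^bsub>G\<^esub>")
        case True
        then show ?thesis using additive_subgroup.zero_closed[OF K.is_additive_subgroup] by simp
      next
        case False
        define b where "b = g (lead x mod m)"
        have xC: "x \<in> C (lead x mod m)" using less.prems False by (simp add: C_def)
        then have bC: "b \<in> C (lead x mod m)" unfolding b_def using g by blast
        then have b: "b \<in> J" "b \<noteq> \<zero>\<^bsub>G\<^esub>" "lead b mod m = lead x mod m" by (auto simp: C_def)
        have bB: "b \<in> B" using xC m_pos by (auto simp: b_def B_def)
        have le: "lead b \<le> lead x" unfolding b_def using least[OF xC] .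
        obtain k where k: "lead x = lead b + k * m"
          using le b(3) by (metis le_add_diff_inverse mod_eq_dvd_iff_nat dvd_div_mult_self)
        define c where "c = - (graded_coeff x (lead x) / graded_coeff b (lead b))"
        define e where "e = axis_elem (Polynomial.monom c k) \<otimes>\<^bsub>G\<^esub> b"
        define y where "y = x \<oplus>\<^bsub>G\<^esub> e"
        have xc: "x \<in> carrier G" and bc: "b \<in> carrier G" using J.Icarr less.prems b(1) by blast+
        have eK: "e \<in> Idl\<^bsub>G\<^esub> B"
          unfolding e_def using G.genideal_self[OF Bc] bB axis_elem_in by (intro K.I_l_closed) auto
        have eJ: "e \<in> J" unfolding e_def using b(1) axis_elem_in by (rule J.I_l_closed)
        have ec: "e \<in> carrier G" using J.Icarr[OF eJ] .
        have yJ: "y \<in> J" unfolding y_def using less.prems eJ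
          by (rule additive_subgroup.a_closed[OF J.is_additive_subgroup])
        have ecoeff: "graded_coeff e s = (if k * m \<le> s then c * graded_coeff b (s - k * m) else 0)" for s
          unfolding e_def by (rule graded_coeff_monomial_mult[OF bc])
        have ycoeff: "graded_coeff y s = graded_coeff x s + graded_coeff e s" for s
          unfolding y_def by (rule graded_coeff_add[OF xc ec])
        have "lead y < lead x" if "y \<noteq> \<zero>\<^bsub>G\<^esub>"
        proof -
          have "graded_coeff y (lead x) = 0"
            using lead(1)[OF b(1,2)] by (simp add: ycoeff ecoeff k[symmetric] c_def) (simp add: k)
          moreover have "s \<le> lead x" if "graded_coeff y s \<noteq> 0" for s
          proof -
            from that have "graded_coeff x s \<noteq> 0 \<or> (k * m \<le> s \<and> graded_coeff b (s - k * m) \<noteq> 0)"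
              by (auto simp: ycoeff ecoeff split: if_splits)
            then show ?thesis
              using lead(2)[OF less.prems False, of s] lead(2)[OF b(1,2), of "s - k * m"] k by auto
          qed
          ultimately show ?thesis using lead(1)[OF yJ that] by (metis le_neq_implies_less)
        qed
        then have "y \<in> Idl\<^bsub>G\<^esub> B" using less.hyps[OF _ yJ] False by auto
        then have "y \<ominus>\<^bsub>G\<^esub> e \<in> Idl\<^bsub>G\<^esub> B"
          unfolding a_minus_def using eK
          by (intro additive_subgroup.a_closed[OF K.is_additive_subgroup]
              additive_subgroup.a_inv_closed[OF K.is_additive_subgroup])
        moreover have "y \<ominus>\<^bsub>G\<^esub> e = x" unfolding y_def using xc ec by algebra
        ultimately show ?thesis by simp
      qed
    qed
    moreover have "Idl\<^bsub>G\<^esub> B \<subseteq> J" using G.genideal_minimal[OF J.is_ideal BJ] .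
    ultimately have "J = Idl\<^bsub>G\<^esub> B" by blast
    moreover have "finite B" by (simp add: B_def)
    ultimately show "\<exists>B\<subseteq>carrier G. finite B \<and> J = Idl\<^bsub>G\<^esub> B" using Bc by blast
  qed
qed

theorem Cohen_Macaulay_tangent_cone:
  "Cohen_Macaulay (tangent_cone (generated_semigroup A) :: (nat \<Rightarrow> 'k::field fps set) ring)"
proof -
  interpret G: cring "G :: (nat \<Rightarrow> 'k fps set) ring" by (rule cring_G)
  interpret polynomial_reduction "G :: (nat \<Rightarrow> 'k fps set) ring" axis
  proof
    show "\<exists>x\<in>carrier G. axis x = p" for p :: "'k poly"
      using axis_elem_in axis_axis_elem by blast
  qed (fact axis_add axis_mult axis_one axis_kernel_nilpotent regular_off_axis_kernel)+
  show ?thesis by (rule Cohen_Macaulay_if_noetherian[OF noetherian_G])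
qed

end


section \<open>Orders in the semigroup generated by \<open>m + i + j(n + 1)\<close>\<close>

text \<open>With \<open>m = n\<^sup>2 + 2n\<close> the four generators are \<open>m + i + j(n + 1)\<close> with \<open>i, j \<in> {0, 1}\<close>.  The sums of \<open>l\<close> of them
are therefore the numbers \<open>lm + i + j(n + 1)\<close> with \<open>i\<close> and \<open>j\<close> ranging independently from \<open>0\<close> to \<open>l\<close>.\<close>

definition grid :: "nat \<Rightarrow> nat \<Rightarrow> nat set" where
  "grid n k = {l * (n^2 + 2*n) + i + j * (n + 1) | l i j. k \<le> l \<and> i \<le> l \<and> j \<le> l}"

lemma gridI:
  "\<lbrakk>s = l * (n^2 + 2*n) + i + j * (n + 1); k \<le> l; i \<le> l; j \<le> l\<rbrakk> \<Longrightarrow> s \<in> grid n k"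
  unfolding grid_def by blast

lemma grid_add:
  assumes "s \<in> grid n k" "t \<in> grid n k'"
  shows "s + t \<in> grid n (k + k')"
proof -
  obtain l i j where s: "s = l * (n^2 + 2*n) + i + j * (n + 1)" "k \<le> l" "i \<le> l" "j \<le> l"
    using assms(1) unfolding grid_def by blast
  obtain l' i' j' where t: "t = l' * (n^2 + 2*n) + i' + j' * (n + 1)" "k' \<le> l'" "i' \<le> l'" "j' \<le> l'"
    using assms(2) unfolding grid_def by blast
  show ?thesis
  proof (rule gridI[of _ "l + l'" _ "i + i'" "j + j'"])
    show "s + t = (l + l') * (n^2 + 2*n) + (i + i') + (j + j') * (n + 1)"
      by (simp add: s(1) t(1) algebra_simps)
  qed (use s t in auto)
qed

text \<open>Cancelling \<open>m\<close> from a sum of \<open>l + 1\<close> generators leaves \<open>s = lm + i + j(n + 1)\<close>, where \<open>i\<close> or \<open>j\<close> may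
exceed \<open>l\<close> by one.  With \<open>q = n + 1\<close>, so that \<open>m = q\<^sup>2 - 1\<close>, the triple \<open>(l, i, j)\<close> can be exchanged without changing
\<open>s\<close> for \<open>(l + 1, i - n, j - n)\<close>, for \<open>(l + 1, i + 1, j - q)\<close> or for \<open>(l, i - q, j + 1)\<close>.  One of these
exchanges repairs the excess, unless \<open>s\<close> is a sum of \<open>l\<close> or more generators anyway.\<close>

lemma grid_descent:
  fixes n :: nat
  assumes s: "s \<in> grid n 0" and t: "s + (n^2 + 2*n) \<in> grid n (Suc L)"
  shows "s \<in> grid n L"
proof -
  define m where "m = n^2 + 2*n"
  obtain l' i' j' where 1: "s = l' * m + i' + j' * (n + 1)" "i' \<le> l'" "j' \<le> l'"
    using s unfolding grid_def m_def by blast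
  obtain l1 i j where 2: "s + m = l1 * m + i + j * (n + 1)" "Suc L \<le> l1" "i \<le> l1" "j \<le> l1"
    using t unfolding grid_def m_def by blast
  obtain l where l: "l1 = Suc l" "L \<le> l" using 2(2) by (cases l1) auto
  have s: "s = l * m + i + j * (n + 1)" "i \<le> Suc l" "j \<le> Suc l" using 2 l by auto
  have goal: "s \<in> grid n L" if "s = l2 * m + i2 + j2 * (n + 1)" "l \<le> l2" "i2 \<le> l2" "j2 \<le> l2" for l2 i2 j2
    by (rule gridI[of s l2 n i2 j2]) (use that l(2) in \<open>auto simp: m_def\<close>)
  consider "l \<le> l'" | "i \<le> l" "j \<le> l" | "n \<le> i" "n \<le> j" | "n < j" "i \<le> l"
    | "l' < l" "j \<le> n" "j = n \<longrightarrow> i < n" "l < i \<or> l < j"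
    using s(2,3) by linarith
  then show ?thesis
  proof cases
    case 1
    then show ?thesis using goal[of l' i' j'] \<open>s = l' * m + i' + j' * (n + 1)\<close> \<open>i' \<le> l'\<close> \<open>j' \<le> l'\<close> by blast
  next
    case 2
    then show ?thesis using goal[of l i j] s by blast
  next
    case 3
    obtain a b where ab: "i = n + a" "j = n + b" using 3 by (metis le_iff_add)
    show ?thesis
    proof (rule goal[of "Suc l" a b])
      show "s = Suc l * m + a + b * (n + 1)"
        by (simp add: s(1) ab m_def algebra_simps power2_eq_square)
    qed (use ab s in auto)
  next
    case 4
    obtain b where b: "j = Suc n + b" using 4(1) by (metis Suc_leI le_iff_add)
    show ?thesis
    proof (rule goal[of "Suc l" "Suc i" b])
      show "s = Suc l * m + Suc i + b * (n + 1)"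
        by (simp add: s(1) b m_def algebra_simps power2_eq_square)
    qed (use b s 4 in auto)
  next
    \<comment> \<open>Here \<open>s\<close> has a representation with \<open>l' < l\<close> summands.  Since \<open>m\<close> is large compared with
      \<open>i' + j'(n + 1)\<close>, this is possible only if \<open>l > n\<close>, so that the excess is in \<open>i\<close>, which is
      at least \<open>q\<close>.\<close>
    case 5
    obtain d where d: "l = Suc (l' + d)" using 5(1) by (metis less_iff_Suc_add)
    have "s \<le> l' * m + l' + l' * (n + 1)"
      unfolding 1(1) by (intro add_mono mult_right_mono order.refl 1 zero_le)
    then have "Suc d * m + i + j * (n + 1) \<le> l' * (n + 2)"
      unfolding s(1) d by (simp add: algebra_simps)
    moreover have "1 * m \<le> Suc d * m" by (intro mult_right_mono) simp_all
    moreover have "m = n * (n + 2)" by (simp add: m_def power2_eq_square algebra_simps)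
    ultimately have le: "n * (n + 2) + i + j * (n + 1) \<le> l' * (n + 2)" by linarith
    then have "n * (n + 2) \<le> l' * (n + 2)" by linarith
    then have "n \<le> l'" by (metis mult_le_cancel2 add_gr_0 zero_less_numeral)
    then have "n < l" using d by simp
    then have i: "i = Suc l" "j < n \<or> j = n" using 5 s(2) by auto
    then have "j < n" using 5(3) \<open>n < l\<close> by auto
    obtain a where a: "i = Suc n + a" using i \<open>n < l\<close> by (metis le_iff_add less_imp_le Suc_leI less_SucI)
    show ?thesis
    proof (rule goal[of l a "Suc j"])
      show "s = l * m + a + Suc j * (n + 1)" by (simp add: s(1) a)
    qed (use i a \<open>j < n\<close> \<open>n < l\<close> in auto)
  qed
qed

text \<open>The elements of order at least \<open>k\<close> are those of \<open>grid n k\<close>, so that \<open>grid_descent\<close> says that cancelling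
\<open>m\<close> lowers the order by at most one.\<close>

lemma order_additive_generators_S4:
  fixes n :: nat
  assumes "n \<ge> 1"
  shows "order_additive_generators {n^2 + 2*n, n^2 + 2*n + 1, n^2 + 3*n + 1, n^2 + 3*n + 2}"
proof -
  define m where "m = n^2 + 2*n"
  define A where "A = {n^2 + 2*n, n^2 + 2*n + 1, n^2 + 3*n + 1, n^2 + 3*n + 2}"
  have A: "a \<in> A \<longleftrightarrow> (\<exists>i\<le>1. \<exists>j\<le>1. a = m + i + j * (n + 1))" for a
  proof -
    have "{..1::nat} = {0, 1}" by auto
    then have "(\<exists>i\<le>1. \<exists>j\<le>1. a = m + i + j * (n + 1)) \<longleftrightarrow> (\<exists>i\<in>{0,1}. \<exists>j\<in>{0,1}. a = m + i + j * (n + 1))"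
      by (metis atMost_iff)
    then show ?thesis by (auto simp: A_def m_def)
  qed
  have Min: "Min A = m" by (rule Min_eqI) (auto simp: A_def m_def)
  interpret positive_generators A
    by unfold_locales (use assms in \<open>auto simp: A_def\<close>)
  have grid_gen: "A \<subseteq> grid n 1"
    using gridI[of _ 1 n _ _ 1] by (auto simp: A m_def)
  have generated_grid: "generated_semigroup A \<subseteq> grid n 0"
  proof (rule generated_semigroup_least[OF fin])
    show "A \<subseteq> grid n 0" using grid_gen by (force simp: grid_def)
    show "0 \<in> grid n 0" by (rule gridI[of _ 0 _ 0 0]) auto
    show "s + t \<in> grid n 0" if "s \<in> grid n 0" "t \<in> grid n 0" for s t
      using grid_add[OF that] by simp
  qed
  have power_grid: "semigroup_power A k \<subseteq> grid n k" for k
  proof (induction k)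
    case 0
    show ?case using generated_grid by simp
  next
    case (Suc k)
    then show ?case using grid_add[of _ n k _ 1] grid_gen by auto
  qed
  have mem: "l * m + i + j * (n + 1) \<in> semigroup_power A l" if "i \<le> l" "j \<le> l" for l i j
    using that
  proof (induction l arbitrary: i j)
    case 0
    then show ?case by (simp add: generated_semigroup_zero)
  next
    case (Suc l)
    have "i - (i - 1) \<le> 1" "j - (j - 1) \<le> 1" by auto
    then have "m + (i - (i - 1)) + (j - (j - 1)) * (n + 1) \<in> A" unfolding A by blast
    then have "(l * m + (i - 1) + (j - 1) * (n + 1)) + (m + (i - (i - 1)) + (j - (j - 1)) * (n + 1))
      \<in> semigroup_power A (Suc l)"
      by (intro power_SucI Suc.IH) (use Suc.prems in auto)
    moreover have "(l * m + (i - 1) + (j - 1) * (n + 1)) + (m + (i - (i - 1)) + (j - (j - 1)) * (n + 1))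
        = Suc l * m + i + j * (n + 1)"
      by (cases i; cases j) simp_all
    ultimately show ?case by (simp only:)
  qed
  have grid_power: "grid n k \<subseteq> semigroup_power A k" for k
  proof
    fix s assume "s \<in> grid n k"
    then obtain l i j where "s = l * m + i + j * (n + 1)" "k \<le> l" "i \<le> l" "j \<le> l"
      unfolding grid_def m_def by blast
    then show "s \<in> semigroup_power A k" using mem power_antimono by blast
  qed
  have power_eq: "semigroup_power A k = grid n k" for k
    using power_grid grid_power by blast
  have "order_additive_generators A"
  proof unfold_locales
    fix s assume s: "s \<in> generated_semigroup A"
    have m_S: "m \<in> generated_semigroup A" using m_in A_subset Min by auto
    have "semigroup_ord A m = 1" using ord_multiple[of 1] Min by simp
    then have "semigroup_ord A s + 1 \<le> semigroup_ord A (s + m)" using ord_add[OF s m_S] by simp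
    moreover from this obtain L where L: "semigroup_ord A (s + m) = Suc L"
      by (cases "semigroup_ord A (s + m)") auto
    then have "s + m \<in> semigroup_power A (Suc L)"
      using generated_semigroup_add[OF s m_S] by (subst power_iff) simp
    then have "s \<in> semigroup_power A L"
      using grid_descent[of s n L] generated_grid s by (simp only: power_eq m_def subsetD)
    then have "L \<le> semigroup_ord A s" by (simp add: power_iff)
    ultimately show "semigroup_ord A (s + Min A) = semigroup_ord A s + 1" using L Min by simp
  qed
  then show ?thesis unfolding A_def .
qed

theorem corollary5p7:
  fixes n :: nat
  assumes "n \<ge> 5"
  shows "Cohen_Macaulay (tangent_cone (semigroup_S4 n) :: (nat \<Rightarrow> 'k::field fps set) ring)"
proof -
  interpret order_additive_generators "{n^2 + 2*n, n^2 + 2*n + 1, n^2 + 3*n + 1, n^2 + 3*n + 2}"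
    using assms by (intro order_additive_generators_S4) simp
  show ?thesis
    unfolding semigroup_S4_def by (rule Cohen_Macaulay_tangent_cone)
qed

end
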